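(* Suppose that $\mathcal{A}$ and $\mathcal{B}$ are vertex realizable operators on $\Lambda_{q,t}$ of weights $r$ and $s$, with kernels $K_{\mathcal{A}}(z_r,\dots,z_1)$ and $K_{\mathcal{B}}(z_s,\dots,z_1)$ respectively. Then the composition $\mathcal{A}\mathcal{B}$ is a vertex realizable operator of weight $r+s$ with kernel $$\exp\Bigl(-\sum_{n=1}^\infty\frac{(1-t^{-n})(1-q^n)}{n}\sum_{\alpha=s+1}^{r+s}z_\alpha^{-n}\sum_{\beta=1}^{s}z_\beta^{n}\Bigr)\cdot K_{\mathcal{A}}(z_{r+s},\dots,z_{s+1})\,K_{\mathcal{B}}(z_s,\dots,z_1).$$
   Context: $\Lambda$ is the ring of symmetric functions, $\Lambda_{q,t}=\Lambda\otimes\mathbb{C}(q,t)$, $p_n$ are the power sums, $P_\mu(x;q,t)$ the Macdonald symmetric functions. Definition. An operator $\mathcal{A}:\Lambda_{q,t}\to\Lambda_{q,t}$ having all $P_\mu(x;q,t)$ as eigenvectors (with eigenvalues $a_\mu(q,t)$) is called vertex realizable of weight $r\ge1$ if there is a Laurent series $K_{\mathcal{A}}(z_r,\dots,z_1)$ with coefficients in $\mathbb{C}(q,t)$, called the kernel of $\mathcal{A}$, such that $$\mathcal{A}=\Bigl[K_{\mathcal{A}}(z_r,\dots,z_1)\exp\Bigl(\sum_{n\ge1}\tfrac{1-t^{-n}}{n}p_n\sum_{\alpha=1}^rz_\alpha^n\Bigr)\exp\Bigl(-\sum_{n\ge1}\tfrac{1-q^n}{n}\sum_{\alpha=1}^rz_\alpha^{-n}\,n\tfrac{\partial}{\partial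 p_n}\Bigr)\Bigr]\Big|_{z_r^0z_{r-1}^0\cdots z_1^0}.$$ Here $|_{z_r^0\cdots z_1^0}$ means taking the constant term first in $z_r$, then in $z_{r-1}$, and so on. Kernels are formal iterated Laurent series in $\mathbb{C}(q,t)((z_r))\cdots((z_1))$ (i.e. ratios are expanded in powers of $z_\alpha/z_\beta$ for $\alpha<\beta$); in particular the exponential in the claim is expanded in powers of $z_\beta/z_\alpha$ with $\beta\le s<\alpha$. *)

theory Defs
  imports
    "HOL-Library.Poly_Mapping"
    "HOL-Library.Groups_Big_Fun"
    "HOL-Computational_Algebra.Polynomial"
    "HOL-Computational_Algebra.Fraction_Field"
begin

section \<open>The coefficient field and the ring of symmetric functions\<close>

text \<open>The field \<open>\<complex>(q,t)\<close>, as the fraction field of \<open>\<complex>[q][t]\<close>.\<close>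

type_synonym qt = "complex poly poly fract"

definition q_ind :: qt where
  "q_ind = Fract [:[:0, 1:]:] 1"

definition t_ind :: qt where
  "t_ind = Fract [:0, 1:] 1"

text \<open>
  Polynomials over \<open>\<complex>(q,t)\<close> in countably many indeterminates: the finitely supported functions
  on exponent vectors, with the convolution product of \<open>poly_mapping\<close>.
\<close>

type_synonym qt_mpoly = "(nat \<Rightarrow>\<^sub>0 nat) \<Rightarrow>\<^sub>0 qt"

text \<open>
  \<open>\<Lambda>\<^sub>q\<^sub>,\<^sub>t\<close> is the free commutative algebra on the power sums \<open>p\<^sub>1, p\<^sub>2, \<dots>\<close>. Since indeterminates are
  numbered from \<open>0\<close>, the power sum \<open>p\<^sub>n\<close> (\<open>n \<ge> 1\<close>) is the indeterminate with number \<open>n - 1\<close>.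
  The realization by polynomials in variables \<open>x\<^sub>i\<close> is \<open>in_vars\<close> below.
\<close>

type_synonym sym = qt_mpoly

definition const :: "qt \<Rightarrow> qt_mpoly" where
  "const c = Poly_Mapping.single 0 c"

definition smult :: "qt \<Rightarrow> qt_mpoly \<Rightarrow> qt_mpoly" where
  "smult c f = const c * f"

definition psum :: "nat \<Rightarrow> sym" where
  "psum n = Poly_Mapping.single (Poly_Mapping.single (n - 1) 1) 1"

definition psum_deriv :: "nat \<Rightarrow> sym \<Rightarrow> sym" where
  "psum_deriv n f =
     (\<Sum>m\<in>Poly_Mapping.keys f.
        Poly_Mapping.single (m - Poly_Mapping.single (n - 1) 1)
          (of_nat (Poly_Mapping.lookup m (n - 1)) * Poly_Mapping.lookup f m))"


section \<open>Macdonald symmetric functions\<close>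

definition is_partition :: "nat list \<Rightarrow> bool" where
  "is_partition \<mu> \<longleftrightarrow> sorted_wrt (\<ge>) \<mu> \<and> 0 \<notin> set \<mu>"

definition dominated :: "nat list \<Rightarrow> nat list \<Rightarrow> bool" where
  "dominated \<nu> \<mu> \<longleftrightarrow> sum_list \<nu> = sum_list \<mu> \<and> (\<forall>k. sum_list (take k \<nu>) \<le> sum_list (take k \<mu>))"

text \<open>\<open>psum_vars N n\<close> is \<open>x\<^sub>0\<^sup>n + \<dots> + x\<^sub>N\<^sub>-\<^sub>1\<^sup>n\<close>, and \<open>in_vars N f\<close> is the symmetric polynomial
  \<open>f(x\<^sub>0, \<dots>, x\<^sub>N\<^sub>-\<^sub>1)\<close>.\<close>

definition psum_vars :: "nat \<Rightarrow> nat \<Rightarrow> qt_mpoly" where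
  "psum_vars N n = (\<Sum>i<N. Poly_Mapping.single (Poly_Mapping.single i n) 1)"

definition in_vars :: "nat \<Rightarrow> sym \<Rightarrow> qt_mpoly" where
  "in_vars N f =
     (\<Sum>m\<in>Poly_Mapping.keys f.
        smult (Poly_Mapping.lookup f m)
          (\<Prod>i\<in>Poly_Mapping.keys m. psum_vars N (i + 1) ^ Poly_Mapping.lookup m i))"

text \<open>The monomial symmetric polynomial \<open>m\<^sub>\<mu>(x\<^sub>0, \<dots>, x\<^sub>N\<^sub>-\<^sub>1)\<close>.\<close>

definition monomial_vars :: "nat \<Rightarrow> nat list \<Rightarrow> qt_mpoly" where
  "monomial_vars N \<mu> =
     (\<Sum>a | Poly_Mapping.keys a \<subseteq> {..<N} \<and>
            image_mset (Poly_Mapping.lookup a) (mset_set (Poly_Mapping.keys a)) = mset \<mu>.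
        Poly_Mapping.single a 1)"

text \<open>
  The scalar product with \<open>\<langle>p\<^sub>\<lambda>, p\<^sub>\<mu>\<rangle> = \<delta>\<^sub>\<lambda>\<^sub>\<mu> \<Prod>\<^sub>i (i^m\<^sub>i m\<^sub>i!) \<Prod>\<^sub>j (1 - q^\<lambda>\<^sub>j) / (1 - t^\<lambda>\<^sub>j)\<close>, where \<open>m\<^sub>i\<close> is the
  multiplicity of the part \<open>i\<close> in \<open>\<lambda>\<close>, that is, the exponent of \<open>p\<^sub>i\<close> in \<open>p\<^sub>\<lambda>\<close>.
\<close>

definition psum_norm :: "(nat \<Rightarrow>\<^sub>0 nat) \<Rightarrow> qt" where
  "psum_norm m =
     (\<Prod>i\<in>Poly_Mapping.keys m.
        of_nat ((i + 1) ^ Poly_Mapping.lookup m i * fact (Poly_Mapping.lookup m i)) *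
        ((1 - q_ind ^ (i + 1)) / (1 - t_ind ^ (i + 1))) ^ Poly_Mapping.lookup m i)"

definition qt_inner :: "sym \<Rightarrow> sym \<Rightarrow> qt" where
  "qt_inner f g =
     (\<Sum>m\<in>Poly_Mapping.keys f. Poly_Mapping.lookup f m * Poly_Mapping.lookup g m * psum_norm m)"

text \<open>
  Macdonald's characterization: \<open>P\<^sub>\<mu>\<close> is \<open>m\<^sub>\<mu>\<close> plus a combination of \<open>m\<^sub>\<nu>\<close> with \<open>\<nu>\<close> strictly below
  \<open>\<mu>\<close> in the dominance order, and distinct \<open>P\<^sub>\<mu>\<close> are orthogonal. The coefficients \<open>c \<nu>\<close> do not
  depend on the number \<open>N\<close> of variables, so this is an identity of symmetric functions.
\<close>

definition macdonald_family :: "(nat list \<Rightarrow> sym) \<Rightarrow> bool" where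
  "macdonald_family P \<longleftrightarrow>
     (\<forall>\<mu>. is_partition \<mu> \<longrightarrow>
        (\<exists>c :: nat list \<Rightarrow> qt. \<forall>N.
           in_vars N (P \<mu>) = monomial_vars N \<mu> +
             (\<Sum>\<nu> | is_partition \<nu> \<and> dominated \<nu> \<mu> \<and> \<nu> \<noteq> \<mu>. smult (c \<nu>) (monomial_vars N \<nu>)))) \<and>
     (\<forall>\<mu> \<nu>. is_partition \<mu> \<and> is_partition \<nu> \<and> \<mu> \<noteq> \<nu> \<longrightarrow> qt_inner (P \<mu>) (P \<nu>) = 0)"

definition macdonald_P :: "nat list \<Rightarrow> sym" where
  "macdonald_P \<mu> = (THE f. \<exists>P. macdonald_family P \<and> f = P \<mu>)"

definition macdonald_diagonal :: "(sym \<Rightarrow> sym) \<Rightarrow> bool" where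
  "macdonald_diagonal A \<longleftrightarrow>
     Vector_Spaces.linear smult smult A \<and>
     (\<forall>\<mu>. is_partition \<mu> \<longrightarrow>
        macdonald_P \<mu> \<noteq> 0 \<and> (\<exists>a. A (macdonald_P \<mu>) = smult a (macdonald_P \<mu>)))"


section \<open>Formal series in the variables \<open>z\<^sub>1, z\<^sub>2, \<dots>\<close>\<close>

text \<open>
  A formal series assigns a coefficient to each Laurent monomial \<open>\<Prod>\<^sub>\<alpha> z\<^sub>\<alpha>^(m \<alpha>)\<close>. Infinite sums and
  products of series are formed coefficientwise by \<open>Sum_any\<close>, which is meaningful where
  only finitely many terms contribute to a coefficient (applied to a fixed vector, in the
  case of operator coefficients).
\<close>

type_synonym zmon = "nat \<Rightarrow>\<^sub>0 int"
type_synonym 'a zseries = "zmon \<Rightarrow> 'a"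

definition zpow :: "nat \<Rightarrow> int \<Rightarrow> qt zseries" where
  "zpow \<alpha> k = (\<lambda>m. if m = Poly_Mapping.single \<alpha> k then 1 else 0)"

text \<open>The sum of \<open>g n\<close> over all \<open>n \<ge> 1\<close>.\<close>

definition sum_pos :: "(nat \<Rightarrow> 'a::comm_monoid_add) \<Rightarrow> 'a" where
  "sum_pos g = Sum_any (\<lambda>k. g (Suc k))"

text \<open>
  Support condition for \<open>\<complex>(q,t)((z\<^sub>r))\<dots>((z\<^sub>1))\<close>: once the exponents of \<open>z\<^sub>1, \<dots>, z\<^sub>\<alpha>\<^sub>-\<^sub>1\<close> are
  fixed, those of \<open>z\<^sub>\<alpha>\<close> are bounded below.
\<close>

definition iterated_laurent :: "nat \<Rightarrow> qt zseries \<Rightarrow> bool" where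
  "iterated_laurent r K \<longleftrightarrow>
     (\<forall>m. K m \<noteq> 0 \<longrightarrow> Poly_Mapping.keys m \<subseteq> {1..r}) \<and>
     (\<forall>\<alpha>\<in>{1..r}. \<forall>e :: nat \<Rightarrow> int. \<exists>b. \<forall>m.
        K m \<noteq> 0 \<and> (\<forall>\<beta>\<in>{1..<\<alpha>}. Poly_Mapping.lookup m \<beta> = e \<beta>) \<longrightarrow> b \<le> Poly_Mapping.lookup m \<alpha>)"

definition zmult :: "qt zseries \<Rightarrow> qt zseries \<Rightarrow> qt zseries" where
  "zmult F G = (\<lambda>m. Sum_any (\<lambda>d. F d * G (m - d)))"

definition zone :: "qt zseries" where
  "zone = (\<lambda>m. if m = 0 then 1 else 0)"

definition zexp :: "qt zseries \<Rightarrow> qt zseries" where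
  "zexp F = (\<lambda>m. Sum_any (\<lambda>k. (zmult F ^^ k) zone m / of_nat (fact k)))"

text \<open>The substitution \<open>z\<^sub>\<alpha> \<mapsto> z\<^sub>\<alpha>\<^sub>+\<^sub>s\<close>, for series in \<open>z\<^sub>1, z\<^sub>2, \<dots>\<close>.\<close>

definition zshift :: "nat \<Rightarrow> qt zseries \<Rightarrow> qt zseries" where
  "zshift s K =
     (\<lambda>m. if Poly_Mapping.keys m \<subseteq> {s<..} then K (Poly_Mapping.map_key (\<lambda>\<alpha>. \<alpha> + s) m) else 0)"

text \<open>The analogous operations on series whose coefficients are operators on \<open>\<Lambda>\<^sub>q\<^sub>,\<^sub>t\<close>.\<close>

definition op_scalar :: "qt zseries \<Rightarrow> (sym \<Rightarrow> sym) zseries" where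
  "op_scalar K = (\<lambda>m f. smult (K m) f)"

definition op_mult :: "(sym \<Rightarrow> sym) zseries \<Rightarrow> (sym \<Rightarrow> sym) zseries \<Rightarrow> (sym \<Rightarrow> sym) zseries" where
  "op_mult S T = (\<lambda>m f. Sum_any (\<lambda>d. S d (T (m - d) f)))"

definition op_one :: "(sym \<Rightarrow> sym) zseries" where
  "op_one = (\<lambda>m f. if m = 0 then f else 0)"

definition op_exp :: "(sym \<Rightarrow> sym) zseries \<Rightarrow> (sym \<Rightarrow> sym) zseries" where
  "op_exp S = (\<lambda>m f. Sum_any (\<lambda>k. smult (1 / of_nat (fact k)) ((op_mult S ^^ k) op_one m f)))"


section \<open>Vertex realizable operators\<close>

text \<open>The exponents of the two exponentials in the vertex operator.\<close>

definition creation_exponent :: "nat \<Rightarrow> (sym \<Rightarrow> sym) zseries" where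
  "creation_exponent r = (\<lambda>m f. sum_pos (\<lambda>n.
     smult ((1 - inverse t_ind ^ n) / of_nat n * (\<Sum>\<alpha>=1..r. zpow \<alpha> (int n) m)) (psum n * f)))"

definition annihilation_exponent :: "nat \<Rightarrow> (sym \<Rightarrow> sym) zseries" where
  "annihilation_exponent r = (\<lambda>m f. - sum_pos (\<lambda>n.
     smult ((1 - q_ind ^ n) / of_nat n * (\<Sum>\<alpha>=1..r. zpow \<alpha> (- int n) m))
       (smult (of_nat n) (psum_deriv n f))))"

text \<open>
  The constant term is the coefficient at \<open>z\<^sub>1\<^sup>0 \<dots> z\<^sub>r\<^sup>0\<close>. In every iterated Laurent series this
  agrees with taking constant terms one variable at a time.
\<close>

definition vertex_operator :: "nat \<Rightarrow> qt zseries \<Rightarrow> sym \<Rightarrow> sym" where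
  "vertex_operator r K =
     op_mult (op_scalar K)
       (op_mult (op_exp (creation_exponent r)) (op_exp (annihilation_exponent r))) 0"

definition vertex_kernel :: "nat \<Rightarrow> qt zseries \<Rightarrow> (sym \<Rightarrow> sym) \<Rightarrow> bool" where
  "vertex_kernel r K A \<longleftrightarrow> iterated_laurent r K \<and> A = vertex_operator r K"

definition vertex_realizable :: "nat \<Rightarrow> (sym \<Rightarrow> sym) \<Rightarrow> bool" where
  "vertex_realizable r A \<longleftrightarrow> 1 \<le> r \<and> macdonald_diagonal A \<and> (\<exists>K. vertex_kernel r K A)"

text \<open>The exponential of
  \<open>- \<Sum>\<^sub>n (1 - t^(-n)) (1 - q^n) / n \<Sum>\<^sub>\<alpha> z\<^sub>\<alpha>^(-n) \<Sum>\<^sub>\<beta> z\<^sub>\<beta>^n\<close>, with \<open>s < \<alpha> \<le> r + s\<close> and \<open>1 \<le> \<beta> \<le> s\<close>.\<close>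

definition cross_factor :: "nat \<Rightarrow> nat \<Rightarrow> qt zseries" where
  "cross_factor r s = zexp (\<lambda>m. - sum_pos (\<lambda>n.
     (1 - inverse t_ind ^ n) * (1 - q_ind ^ n) / of_nat n *
     zmult (\<lambda>d. \<Sum>\<alpha>=s+1..r+s. zpow \<alpha> (- int n) d) (\<lambda>d. \<Sum>\<beta>=1..s. zpow \<beta> (int n) d) m))"

end

theory Submission
  imports Defs "HOL-Library.FuncSet"
begin

text \<open>
  Let \<open>V\<^sub>r(m)\<close> be the coefficient of \<open>z\<^sup>m\<close> in the product of the two exponentials of weight \<open>r\<close>.
  Everything reduces to the identity \<open>V\<^sub>r(a) V\<^sub>s(b) = \<Sum>\<^sub>c C(c) V\<^sub>r\<^sub>+\<^sub>s(a' + b - c)\<close>, where \<open>C(c)\<close> are the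
  coefficients of the cross factor and \<open>a'\<close> is \<open>a\<close> moved to the variables \<open>z\<^sub>s\<^sub>+\<^sub>1, \<dots>, z\<^sub>s\<^sub>+\<^sub>r\<close>.

  Both sides satisfy the same commutation relation with multiplication by a power sum, namely
  \<open>V(m) p\<^sub>n = p\<^sub>n V(m) - (1 - q\<^sup>n) \<Sum>\<^sub>\<alpha> V(m + n e\<^sub>\<alpha>)\<close>, so it suffices to compare them on the constant \<open>1\<close>.
  There, both sides solve the recurrence obtained by applying the Euler derivation in \<open>z\<^sub>1, \<dots>, z\<^sub>s\<close>
  to the exponentials, and this recurrence has only one solution with given terms of degree \<open>\<le> 0\<close>.
\<close>

section \<open>Exponential series and their Euler recurrences\<close>

text \<open>The factor \<open>1 - q^n\<close> in the commutation relation comes from the Heisenberg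
  relation: conjugating \<open>p_n\<close> by the annihilation exponential adds
  \<open>-(1 - q^n)\<close> times the sum of the \<open>z_\<alpha>^(-n)\<close>, and a factor
  \<open>z_\<alpha>^(-n)\<close> moves the index \<open>m\<close> to
  \<open>m + n e_\<alpha>\<close>. Likewise the exponent of the cross factor is the commutator of
  the annihilation exponent in the variables of the left operator with the creation exponent in
  those of the right one. Only the latter exponential has to be crossed, which is why the derivation
  acts on \<open>z_1, ..., z_s\<close> alone. The obstacle is convergence: \<open>Sum_any\<close> is
  0 on an infinite support, so each rearrangement needs a finiteness argument. Two facts supply it.
  On a fixed vector, \<open>V_r(m) f\<close> vanishes once some exponent of \<open>m\<close> is far
  enough below zero; and the exponents in a kernel are bounded below one variable at a time, by a
  bound that depends on the earlier exponents. As the constant term pairs the exponent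
  \<open>d\<close> of the kernel with \<open>-d\<close>, the two bounds work against each
  other.\<close>

lemma of_nat_fract: "(of_nat n :: 'a::idom fract) = Fract (of_nat n) 1"
  by (induction n) (simp_all add: Zero_fract_def One_fract_def add.commute)

text \<open>Exponentials divide by factorials, and the Euler recurrences are solved by cancelling a
  nonzero integer degree.\<close>

instance fract :: ("{idom, ring_char_0}") field_char_0
proof
  show "inj (of_nat :: nat \<Rightarrow> 'a fract)"
    by (rule injI) (simp add: of_nat_fract eq_fract)
qed

lemma Sum_any_sum:
  assumes "finite I" "\<And>i. i \<in> I \<Longrightarrow> finite {x. g i x \<noteq> 0}"
  shows "Sum_any (\<lambda>x. \<Sum>i\<in>I. g i x) = (\<Sum>i\<in>I. Sum_any (g i))"
  using assms
proof (induction I rule: finite_induct)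
  case (insert i I)
  have "finite {x. (\<Sum>j\<in>I. g j x) \<noteq> 0}"
    by (rule finite_subset[of _ "\<Union>j\<in>I. {x. g j x \<noteq> 0}"])
      (use insert in \<open>auto intro: ccontr\<close>)
  with insert show ?case
    by (simp add: Sum_any.distrib)
qed simp

lemma Sum_any_shift:
  fixes f :: "'a::ab_group_add \<Rightarrow> 'b::comm_monoid_add"
  shows "Sum_any (\<lambda>x. f (x + c)) = Sum_any f"
proof (rule sym, rule Sum_any.reindex_cong[of "\<lambda>x. x + c"])
  show "bij (\<lambda>x. x + c)"
    by (rule bij_betw_byWitness[of _ "\<lambda>x. x - c"]) auto
qed (simp add: o_def)

text \<open>
  The grading \<open>w\<close> makes the coefficients of the exponential \<open>E\<close> of \<open>S\<close> finite sums. Operator series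
  are treated by following their action on one vector \<open>v\<close>, which also covers scalar series.
\<close>

locale exp_series = vector_space scale
  for scale :: "'k::field_char_0 \<Rightarrow> 'v::ab_group_add \<Rightarrow> 'v" +
  fixes S :: "zmon \<Rightarrow> 'v \<Rightarrow> 'v" and I :: "'i set" and e :: "'i \<Rightarrow> zmon"
    and L :: "'i \<Rightarrow> 'v \<Rightarrow> 'v" and w :: "zmon \<Rightarrow> int"
  assumes finI: "\<And>N. finite {i \<in> I. w (e i) \<le> N}"
    and inj_e: "inj_on e I"
    and S_e: "\<And>i v. i \<in> I \<Longrightarrow> S (e i) v = L i v"
    and S_0: "\<And>x v. x \<notin> e ` I \<Longrightarrow> S x v = 0"
    and w_add: "\<And>x y. w (x + y) = w x + w y"
    and w_e: "\<And>i. i \<in> I \<Longrightarrow> w (e i) \<ge> 1"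
    and L_add: "\<And>i v v'. i \<in> I \<Longrightarrow> L i (v + v') = L i v + L i v'"
    and L_scale: "\<And>i c v. i \<in> I \<Longrightarrow> L i (scale c v) = scale c (L i v)"
    and L_comm: "\<And>i j v. i \<in> I \<Longrightarrow> j \<in> I \<Longrightarrow> L i (L j v) = L j (L i v)"
begin

text \<open>The cutoff \<open>N\<close> is a parameter rather than the weight of a monomial, so that
  one finite index set serves a monomial and all those obtained from it by removing terms
  \<open>e i\<close>.\<close>

definition J :: "int \<Rightarrow> 'i set" where "J N = {i \<in> I. w (e i) \<le> N}"

text \<open>The coefficients of the \<open>k\<close>-th power of \<open>S\<close> applied to
  \<open>v\<close>. The recursion has the shape of both \<open>op_mult\<close> and
  \<open>zmult\<close>, so operator and scalar exponentials are instances.\<close>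

primrec iter :: "'v \<Rightarrow> nat \<Rightarrow> zmon \<Rightarrow> 'v" where
  "iter v 0 = (\<lambda>m. if m = 0 then v else 0)"
| "iter v (Suc k) = (\<lambda>m. Sum_any (\<lambda>d. S d (iter v k (m - d))))"

definition E :: "'v \<Rightarrow> zmon \<Rightarrow> 'v" where
  "E v m = Sum_any (\<lambda>k. scale (1 / of_nat (fact k)) (iter v k m))"

lemma finite_J [simp]: "finite (J N)"
  by (simp add: J_def finI)

lemma J_I: "i \<in> J N \<Longrightarrow> i \<in> I"
  by (simp add: J_def)

lemma w_0 [simp]: "w 0 = 0"
  using w_add[of 0 0] by simp

lemma w_diff: "w (x - y) = w x - w y"
  using w_add[of "x - y" y] by simp

lemma L_0: "i \<in> I \<Longrightarrow> L i 0 = 0"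
  using L_scale[of i 0 0] by simp

lemma L_sum: "i \<in> I \<Longrightarrow> L i (\<Sum>x\<in>X. g x) = (\<Sum>x\<in>X. L i (g x))"
  by (induction X rule: infinite_finite_induct) (simp_all add: L_0 L_add)

text \<open>Each factor contributes a term of weight at least 1. This truncates both the sum over
  \<open>d\<close> in a power and the sum over \<open>k\<close> in the exponential.\<close>

lemma iter_low: "w m < int k \<Longrightarrow> iter v k m = 0"
proof (induction k arbitrary: m)
  case (Suc k)
  show ?case
  proof (rule ccontr)
    assume "iter v (Suc k) m \<noteq> 0"
    then obtain d where d: "S d (iter v k (m - d)) \<noteq> 0"
      by (auto elim: Sum_any.not_neutral_obtains_not_neutral)
    then obtain i where i: "i \<in> I" "d = e i"
      using S_0[of d] by blast
    with d have "iter v k (m - d) \<noteq> 0"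
      by (auto simp: S_e L_0)
    with Suc.IH have "int k \<le> w (m - d)"
      by force
    with Suc.prems w_e[OF i(1)] i show False
      by (simp add: w_diff)
  qed
qed auto

text \<open>By \<open>iter_low\<close>, a term of weight above \<open>N\<close> would leave a
  monomial of negative weight, where every power vanishes.\<close>

lemma iter_Suc:
  assumes "w m \<le> N"
  shows "iter v (Suc k) m = (\<Sum>i\<in>J N. L i (iter v k (m - e i)))"
proof -
  have "{d. S d (iter v k (m - d)) \<noteq> 0} \<subseteq> e ` J N"
  proof safe
    fix d assume d: "S d (iter v k (m - d)) \<noteq> 0"
    then obtain i where i: "i \<in> I" "d = e i"
      using S_0[of d] by blast
    with d have "iter v k (m - d) \<noteq> 0"
      by (auto simp: S_e L_0)
    with iter_low[of "m - d" k] have "int k \<le> w (m - d)"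
      by force
    with i assms show "d \<in> e ` J N"
      by (auto simp: w_diff J_def)
  qed
  then have "iter v (Suc k) m = (\<Sum>d\<in>e ` J N. S d (iter v k (m - d)))"
    by (simp add: Sum_any.expand_superset)
  also have "\<dots> = (\<Sum>i\<in>J N. S (e i) (iter v k (m - e i)))"
    by (rule sum.reindex_cong[of e])
      (use inj_e in \<open>auto simp: J_def intro: inj_on_subset\<close>)
  also have "\<dots> = (\<Sum>i\<in>J N. L i (iter v k (m - e i)))"
    by (rule sum.cong) (auto simp: S_e J_I)
  finally show ?thesis .
qed

text \<open>
  Every additive \<open>u\<close> defines a derivation \<open>z\<^sup>m \<mapsto> u(m) z\<^sup>m\<close>, and as the coefficients of \<open>S\<close> commute,
  the derivative of \<open>S\<^sup>k\<^sup>+\<^sup>1\<close> is \<open>k + 1\<close> times the derivative of \<open>S\<close> times \<open>S\<^sup>k\<close>.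
\<close>

lemma iter_euler:
  fixes u :: "zmon \<Rightarrow> int"
  assumes u: "\<And>x y. u (x + y) = u x + u y" and "w m \<le> N"
  shows "scale (of_int (u m)) (iter v (Suc k) m) =
    scale (of_nat (Suc k)) (\<Sum>i\<in>J N. scale (of_int (u (e i))) (L i (iter v k (m - e i))))"
  using assms(2)
proof (induction k arbitrary: m)
  case 0
  have "scale (of_int (u m)) (iter v (Suc 0) m) =
      (\<Sum>i\<in>J N. scale (of_int (u m)) (L i (iter v 0 (m - e i))))"
    unfolding iter_Suc[OF 0] scale_sum_right ..
  \<comment> \<open>\<open>iter v 0\<close> is supported at 0, so only \<open>e i = m\<close>
    survives, where the two scalars agree.\<close>
  also have "\<dots> = (\<Sum>i\<in>J N. scale (of_int (u (e i))) (L i (iter v 0 (m - e i))))"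
    by (rule sum.cong) (auto simp: L_0 J_I)
  finally show ?case by simp
next
  case (Suc k)
  have u': "u m = u (e i) + u (m - e i)" for i
    using u[of "e i" "m - e i"] by simp
  have w': "w (m - e i) \<le> N" if "i \<in> J N" for i
    using w_e[OF J_I[OF that]] Suc.prems by (simp add: w_diff)
  let ?D = "\<lambda>k. \<Sum>i\<in>J N. scale (of_int (u (e i))) (L i (iter v k (m - e i)))"
  have "scale (of_int (u m)) (iter v (Suc (Suc k)) m) =
      (\<Sum>i\<in>J N. scale (of_int (u m)) (L i (iter v (Suc k) (m - e i))))"
    unfolding iter_Suc[OF Suc.prems, of v "Suc k"] scale_sum_right ..
  \<comment> \<open>Product rule: the derivation falls on the first factor or on the remaining
    power.\<close>
  also have "\<dots> = (\<Sum>i\<in>J N. scale (of_int (u (e i))) (L i (iter v (Suc k) (m - e i))) +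
      L i (scale (of_int (u (m - e i))) (iter v (Suc k) (m - e i))))"
  proof (rule sum.cong, rule refl)
    fix i assume i: "i \<in> J N"
    have "scale (of_int (u m)) x = scale (of_int (u (e i))) x + scale (of_int (u (m - e i))) x" for x
      by (subst u'[of i]) (simp add: scale_left_distrib)
    then show "scale (of_int (u m)) (L i (iter v (Suc k) (m - e i))) =
      scale (of_int (u (e i))) (L i (iter v (Suc k) (m - e i))) +
      L i (scale (of_int (u (m - e i))) (iter v (Suc k) (m - e i)))"
      by (simp only: L_scale[OF J_I[OF i]])
  qed
  also have "\<dots> = ?D (Suc k) +
      (\<Sum>i\<in>J N. L i (scale (of_int (u (m - e i))) (iter v (Suc k) (m - e i))))"
    by (simp only: sum.distrib)
  \<comment> \<open>The induction hypothesis differentiates the remaining power, and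
    \<open>L_comm\<close> moves the differentiated factor to the front. After swapping the sums, the
    other factors recombine by \<open>iter_Suc\<close>.\<close>
  also have "(\<Sum>i\<in>J N. L i (scale (of_int (u (m - e i))) (iter v (Suc k) (m - e i)))) =
      (\<Sum>i\<in>J N. \<Sum>j\<in>J N. scale (of_nat (Suc k)) (scale (of_int (u (e j)))
         (L j (L i (iter v k (m - e j - e i))))))"
  proof (rule sum.cong, rule refl)
    fix i assume i: "i \<in> J N"
    have *: "m - e i - e j = m - e j - e i" for j
      by (simp add: algebra_simps)
    show "L i (scale (of_int (u (m - e i))) (iter v (Suc k) (m - e i))) =
      (\<Sum>j\<in>J N. scale (of_nat (Suc k)) (scale (of_int (u (e j)))
         (L j (L i (iter v k (m - e j - e i))))))"
      unfolding Suc.IH[OF w'[OF i]] scale_sum_right L_sum[OF J_I[OF i]]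
      by (rule sum.cong) (use i in \<open>auto simp: L_scale J_I * L_comm[of i]\<close>)
  qed
  also have "\<dots> = (\<Sum>j\<in>J N. scale (of_nat (Suc k)) (scale (of_int (u (e j)))
         (L j (\<Sum>i\<in>J N. L i (iter v k (m - e j - e i))))))"
    by (subst sum.swap, rule sum.cong) (auto simp: scale_sum_right L_sum J_I)
  also have "\<dots> = (\<Sum>j\<in>J N. scale (of_nat (Suc k)) (scale (of_int (u (e j)))
         (L j (iter v (Suc k) (m - e j)))))"
    by (rule sum.cong) (auto simp: iter_Suc[OF w'] simp del: iter.simps)
  also have "\<dots> = scale (of_nat (Suc k)) (?D (Suc k))"
    by (simp only: scale_sum_right)
  also have "?D (Suc k) + \<dots> = scale (of_nat (Suc (Suc k))) (?D (Suc k))"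
    unfolding of_nat_Suc[of "Suc k"] scale_left_distrib scale_one ..
  finally show ?case .
qed

lemma E_upto:
  assumes "w m < int K"
  shows "E v m = (\<Sum>k<K. scale (1 / of_nat (fact k)) (iter v k m))"
  unfolding E_def
proof (rule Sum_any.expand_superset)
  show "{k. scale (1 / of_nat (fact k)) (iter v k m) \<noteq> 0} \<subseteq> {..<K}"
  proof safe
    fix k assume "scale (1 / of_nat (fact k)) (iter v k m) \<noteq> 0"
    then have "iter v k m \<noteq> 0" by auto
    then have "\<not> w m < int k" using iter_low by blast
    with assms show "k < K" by simp
  qed
qed simp

lemma E_low: "w m \<le> 0 \<Longrightarrow> E v m = (if m = 0 then v else 0)"
  using E_upto[of m 1] by simp

text \<open>Sum \<open>iter_euler\<close> over \<open>k\<close>: the factor \<open>Suc k\<close>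
  turns \<open>1 / fact (Suc k)\<close> into \<open>1 / fact k\<close>. The derivation
  \<open>u\<close> is independent of the grading \<open>w\<close>, which only controls
  finiteness.\<close>

lemma E_euler:
  fixes u :: "zmon \<Rightarrow> int"
  assumes u: "\<And>x y. u (x + y) = u x + u y" and "w m \<le> N"
  shows "scale (of_int (u m)) (E v m) =
    (\<Sum>i\<in>J N. scale (of_int (u (e i))) (L i (E v (m - e i))))"
proof -
  define K where "K = Suc (nat (w m))"
  have u0: "u 0 = 0" using u[of 0 0] by simp
  have K: "w m < int K" "w m < int (Suc K)"
    by (auto simp: K_def)
  have "scale (of_int (u m)) (E v m) =
      (\<Sum>k<Suc K. scale (1 / of_nat (fact k)) (scale (of_int (u m)) (iter v k m)))"
    unfolding E_upto[OF K(2)] scale_sum_right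
    by (rule sum.cong) (simp_all add: mult.commute)
  \<comment> \<open>The term \<open>k = 0\<close> drops because \<open>u 0 = 0\<close>; the
    expansion above runs one step further to make up for it.\<close>
  also have "\<dots> = (\<Sum>k<K. scale (1 / of_nat (fact (Suc k)))
      (scale (of_int (u m)) (iter v (Suc k) m)))"
    unfolding sum.lessThan_Suc_shift by (simp add: u0 del: iter.simps(2))
  also have "\<dots> = (\<Sum>k<K. scale (1 / of_nat (fact k))
      (\<Sum>i\<in>J N. scale (of_int (u (e i))) (L i (iter v k (m - e i)))))"
  proof (rule sum.cong, rule refl)
    fix k
    have "1 / (a * b) * a = 1 / b" if "a \<noteq> 0" for a b :: 'k
      using that by simp
    from this[OF of_nat_neq_0]
    have "1 / of_nat (fact (Suc k)) * of_nat (Suc k) = (1 / of_nat (fact k) :: 'k)"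
      by (simp only: fact_Suc of_nat_mult of_nat_id)
    then show "scale (1 / of_nat (fact (Suc k))) (scale (of_int (u m)) (iter v (Suc k) m)) =
      scale (1 / of_nat (fact k))
        (\<Sum>i\<in>J N. scale (of_int (u (e i))) (L i (iter v k (m - e i))))"
      by (simp only: iter_euler[OF assms] scale_scale)
  qed
  also have "\<dots> = (\<Sum>i\<in>J N. \<Sum>k<K. scale (of_int (u (e i)))
      (L i (scale (1 / of_nat (fact k)) (iter v k (m - e i)))))"
    unfolding scale_sum_right
    by (subst sum.swap, intro sum.cong) (auto simp: L_scale J_I mult.commute)
  also have "\<dots> = (\<Sum>i\<in>J N. scale (of_int (u (e i))) (L i (E v (m - e i))))"
  proof (rule sum.cong, rule refl)
    fix i assume i: "i \<in> J N"
    then have "w (m - e i) < int K"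
      using w_e[OF J_I[OF i]] K by (simp add: w_diff)
    then show "(\<Sum>k<K. scale (of_int (u (e i)))
        (L i (scale (1 / of_nat (fact k)) (iter v k (m - e i))))) =
      scale (of_int (u (e i))) (L i (E v (m - e i)))"
      by (simp add: E_upto L_sum[OF J_I[OF i]] scale_sum_right)
  qed
  finally show ?thesis .
qed

text \<open>For \<open>w m > 0\<close> the scalar on the left is nonzero in characteristic 0, and
  the right side involves only smaller weights because \<open>w (e i) \<ge> 1\<close>.\<close>

lemma euler_unique:
  fixes F G :: "zmon \<Rightarrow> 'v"
  assumes low: "\<And>m. w m \<le> 0 \<Longrightarrow> F m = G m"
    and F: "\<And>m. w m > 0 \<Longrightarrow> scale (of_int (w m)) (F m) =
      (\<Sum>i\<in>J (w m). scale (of_int (w (e i))) (L i (F (m - e i))))"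
    and G: "\<And>m. w m > 0 \<Longrightarrow> scale (of_int (w m)) (G m) =
      (\<Sum>i\<in>J (w m). scale (of_int (w (e i))) (L i (G (m - e i))))"
  shows "F m = G m"
proof (induction "nat (w m)" arbitrary: m rule: less_induct)
  case less
  show ?case
  proof (cases "w m \<le> 0")
    case False
    have "F (m - e i) = G (m - e i)" if "i \<in> J (w m)" for i
      using less[of "m - e i"] w_e[OF J_I[OF that]] False by (simp add: w_diff)
    with F[of m] G[of m] False have "scale (of_int (w m)) (F m) = scale (of_int (w m)) (G m)"
      by simp
    with False show ?thesis
      by (simp add: scale_left_imp_eq)
  qed (rule low)
qed

text \<open>By the Euler recurrence, a nonzero coefficient at positive weight comes from a nonzero
  one at some \<open>m - e i\<close>. So the support lies in the monoid generated by the
  \<open>e i\<close>.\<close>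

lemma E_support:
  assumes "P 0" and "\<And>m i. P m \<Longrightarrow> i \<in> I \<Longrightarrow> P (m + e i)" and "E v m \<noteq> 0"
  shows "P m"
  using assms(3)
proof (induction "nat (w m)" arbitrary: m rule: less_induct)
  case less
  show ?case
  proof (cases "w m \<le> 0")
    case True
    with less.prems \<open>P 0\<close> show ?thesis
      by (auto simp: E_low split: if_splits)
  next
    case False
    with less.prems have "scale (of_int (w m)) (E v m) \<noteq> 0"
      by simp
    then have "(\<Sum>i\<in>J (w m). scale (of_int (w (e i))) (L i (E v (m - e i)))) \<noteq> 0"
      by (subst (asm) E_euler[OF w_add order_refl])
    then obtain i where i: "i \<in> J (w m)" "scale (of_int (w (e i))) (L i (E v (m - e i))) \<noteq> 0"
      by (meson sum.not_neutral_contains_not_neutral)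
    then have "E v (m - e i) \<noteq> 0"
      by (auto simp: L_0 J_I)
    with less.hyps[of "m - e i"] w_e[OF J_I[OF i(1)]] False have "P (m - e i)"
      by (simp add: w_diff)
    from assms(2)[OF this J_I[OF i(1)]] show ?thesis
      by simp
  qed
qed

lemma E_add: "E (v + v') m = E v m + E v' m"
proof -
  have "iter (v + v') k m = iter v k m + iter v' k m" for k m
    by (induction k arbitrary: m)
      (auto simp: iter_Suc[OF order_refl] L_add J_I sum.distrib simp del: iter.simps(2))
  moreover have w: "w m < int (Suc (nat (w m)))" by simp
  ultimately show ?thesis
    unfolding E_upto[OF w] sum.distrib[symmetric]
    by (simp add: scale_right_distrib del: sum.lessThan_Suc)
qed

lemma E_scale: "E (scale c v) m = scale c (E v m)"
proof -
  have "iter (scale c v) k m = scale c (iter v k m)" for k m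
    by (induction k arbitrary: m)
      (auto simp: iter_Suc[OF order_refl] L_scale J_I scale_sum_right simp del: iter.simps(2))
  moreover have w: "w m < int (Suc (nat (w m)))" by simp
  ultimately show ?thesis
    unfolding E_upto[OF w] scale_sum_right by (simp add: mult.commute del: sum.lessThan_Suc)
qed

end

section \<open>Linear structure of the ring of symmetric functions\<close>

interpretation sym: vector_space smult
proof unfold_locales
  show "smult (a + b) x = smult a x + smult b x" for a b x
    by (simp add: smult_def const_def single_add algebra_simps)
  show "smult a (x + y) = smult a x + smult a y" for a x y
    by (simp add: smult_def algebra_simps)
  show "smult a (smult b x) = smult (a * b) x" for a b x
    by (simp add: smult_def const_def mult_single mult.assoc[symmetric])
  show "smult 1 x = x" for x
    by (simp add: smult_def const_def)
qed

lemma smult_mult_right: "f * smult c g = smult c (f * g)"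
  by (simp add: smult_def mult.left_commute)

lemma smult_mult_left: "smult c f * g = smult c (f * g)"
  by (simp add: smult_def mult.assoc)

section \<open>Multiplication and differentiation by power sums, coefficient by coefficient\<close>

lemma lookup_single_mult:
  fixes p :: "(nat \<Rightarrow>\<^sub>0 nat) \<Rightarrow>\<^sub>0 'a::semiring_0"
  shows "Poly_Mapping.lookup (Poly_Mapping.single x c * p) (x + y) = c * Poly_Mapping.lookup p y"
proof -
  have "(\<lambda>l. Poly_Mapping.lookup (Poly_Mapping.single x c) l *
         (\<Sum>q. Poly_Mapping.lookup p q when x + y = l + q)) =
        (\<lambda>l. if l = x then c * Poly_Mapping.lookup p y else 0)"
    by (auto simp: lookup_single when_def fun_eq_iff)
  then show ?thesis
    by (simp only: lookup_mult) simp
qed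

lemma lookup_single_mult_0:
  fixes p :: "(nat \<Rightarrow>\<^sub>0 nat) \<Rightarrow>\<^sub>0 'a::semiring_0"
  assumes "\<And>y. z \<noteq> x + y"
  shows "Poly_Mapping.lookup (Poly_Mapping.single x c * p) z = 0"
proof -
  have "(\<lambda>l. Poly_Mapping.lookup (Poly_Mapping.single x c) l *
         (\<Sum>q. Poly_Mapping.lookup p q when z = l + q)) = (\<lambda>l. 0)"
    using assms by (auto simp: lookup_single when_def fun_eq_iff)
  then show ?thesis
    by (simp only: lookup_mult) simp
qed

lemma lookup_smult [simp]: "Poly_Mapping.lookup (smult c f) m = c * Poly_Mapping.lookup f m"
  using lookup_single_mult[of 0 c f m] by (simp add: smult_def const_def)

lemma exponent_split:
  fixes m :: "nat \<Rightarrow>\<^sub>0 nat"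
  assumes "Poly_Mapping.lookup m i > 0"
  shows "m = Poly_Mapping.single i 1 + (m - Poly_Mapping.single i 1)"
  by (rule poly_mapping_eqI) (use assms in \<open>auto simp: lookup_add lookup_minus lookup_single when_def\<close>)

lemma lookup_psum_mult:
  "Poly_Mapping.lookup (psum n * f) m =
    (if Poly_Mapping.lookup m (n - 1) > 0
     then Poly_Mapping.lookup f (m - Poly_Mapping.single (n - 1) 1) else 0)"
proof (cases "Poly_Mapping.lookup m (n - 1) > 0")
  case True
  with lookup_single_mult[of "Poly_Mapping.single (n - 1) 1" 1 f "m - Poly_Mapping.single (n - 1) 1"]
  show ?thesis
    unfolding exponent_split[OF True, symmetric] by (simp add: psum_def)
next
  case False
  have "m \<noteq> Poly_Mapping.single (n - 1) 1 + y" for y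
    using False by (metis add_gr_0 lookup_add lookup_single_eq zero_less_one)
  with False show ?thesis
    by (simp add: psum_def lookup_single_mult_0)
qed

lemma lookup_psum_deriv:
  "Poly_Mapping.lookup (psum_deriv n f) m =
    of_nat (Poly_Mapping.lookup m (n - 1) + 1) *
      Poly_Mapping.lookup f (m + Poly_Mapping.single (n - 1) 1)"
proof -
  let ?x = "Poly_Mapping.single (n - 1) 1 :: nat \<Rightarrow>\<^sub>0 nat"
  let ?g = "\<lambda>k. of_nat (Poly_Mapping.lookup k (n - 1)) * Poly_Mapping.lookup f k"
  \<comment> \<open>Subtraction of exponents is truncated, so \<open>k - ?x = m\<close> determines
    \<open>k\<close> only if \<open>p_n\<close> occurs in \<open>k\<close>; otherwise the
    coefficient \<open>?g k\<close> is 0.\<close>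
  have eq: "(?g k when k - ?x = m) = (if k = m + ?x then ?g k else 0)" for k
  proof (cases "Poly_Mapping.lookup k (n - 1) = 0")
    case True
    then show ?thesis
      by (auto simp: when_def)
  next
    case False
    then have "k = ?x + (k - ?x)"
      by (intro exponent_split) simp
    then have "k - ?x = m \<longleftrightarrow> k = m + ?x"
      by (metis add.commute add_diff_cancel_right')
    then show ?thesis
      by (simp add: when_def)
  qed
  have "Poly_Mapping.lookup (psum_deriv n f) m =
      (\<Sum>k\<in>Poly_Mapping.keys f. if k = m + ?x then ?g k else 0)"
    by (simp only: psum_deriv_def lookup_sum lookup_single eq)
  also have "\<dots> = ?g (m + ?x)"
    by (simp add: in_keys_iff)
  also have "\<dots> = of_nat (Poly_Mapping.lookup m (n - 1) + 1) * Poly_Mapping.lookup f (m + ?x)"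
    by (simp add: lookup_add)
  finally show ?thesis .
qed

lemma psum_deriv_add: "psum_deriv n (f + g) = psum_deriv n f + psum_deriv n g"
  by (rule poly_mapping_eqI) (simp only: lookup_psum_deriv lookup_add distrib_left)

lemma psum_deriv_smult: "psum_deriv n (smult c f) = smult c (psum_deriv n f)"
  by (rule poly_mapping_eqI) (simp add: lookup_psum_deriv)

lemma psum_deriv_one: "psum_deriv n 1 = 0"
proof (rule poly_mapping_eqI)
  fix m :: "nat \<Rightarrow>\<^sub>0 nat"
  have "m + Poly_Mapping.single (n - 1) 1 \<noteq> 0"
    by (metis add_gr_0 lookup_add lookup_single_eq lookup_zero less_numeral_extra(1) less_nat_zero_code)
  then show "Poly_Mapping.lookup (psum_deriv n 1) m = Poly_Mapping.lookup 0 m"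
    by (simp add: lookup_psum_deriv lookup_one)
qed

lemma psum_deriv_commute: "psum_deriv n (psum_deriv k f) = psum_deriv k (psum_deriv n f)"
proof (cases "n - 1 = k - 1")
  \<comment> \<open>The indices 0 and 1 name the same indeterminate, so the cases compare
    \<open>n - 1\<close> with \<open>k - 1\<close>.\<close>
  case True
  then have "psum_deriv n = psum_deriv k"
    by (intro ext) (simp only: psum_deriv_def)
  then show ?thesis by simp
next
  case False
  show ?thesis
  proof (rule poly_mapping_eqI)
    fix m
    have "m + Poly_Mapping.single (n - 1) 1 + Poly_Mapping.single (k - 1) 1 =
      m + Poly_Mapping.single (k - 1) 1 + Poly_Mapping.single (n - 1) (1::nat)"
      by (simp only: ac_simps)
    with False show "Poly_Mapping.lookup (psum_deriv n (psum_deriv k f)) m =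
        Poly_Mapping.lookup (psum_deriv k (psum_deriv n f)) m"
      by (simp add: lookup_psum_deriv lookup_add lookup_single_not_eq mult.left_commute
          del: of_nat_Suc)
  qed
qed

text \<open>The Heisenberg relation, the source of all commutators below. The bounds on
  \<open>n\<close> and \<open>k\<close> separate the indices 0 and 1, which share an
  indeterminate.\<close>

lemma psum_deriv_psum_mult:
  assumes "n \<ge> 1" "k \<ge> 1"
  shows "psum_deriv k (psum n * f) = psum n * psum_deriv k f + (if k = n then f else 0)"
proof (rule poly_mapping_eqI)
  fix m :: "nat \<Rightarrow>\<^sub>0 nat"
  let ?x = "\<lambda>i. Poly_Mapping.single (i - 1) 1 :: nat \<Rightarrow>\<^sub>0 nat"
  show "Poly_Mapping.lookup (psum_deriv k (psum n * f)) m =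
    Poly_Mapping.lookup (psum n * psum_deriv k f + (if k = n then f else 0)) m"
  proof (cases "k = n")
    case True
    have "m - ?x n + ?x n = m" if "Poly_Mapping.lookup m (n - 1) > 0"
      using exponent_split[OF that] by (simp add: add.commute)
    with True show ?thesis
      by (auto simp: lookup_psum_deriv lookup_psum_mult lookup_add lookup_minus distrib_right)
  next
    case False
    with assms have ne: "k - 1 \<noteq> n - 1" by simp
    have "m + ?x k - ?x n = m - ?x n + ?x k" if pos: "Poly_Mapping.lookup m (n - 1) > 0"
    proof -
      obtain y where "m = ?x n + y"
        using exponent_split[OF pos] by blast
      then show ?thesis
        by (simp add: add.assoc)
    qed
    with False ne show ?thesis
      by (auto simp: lookup_psum_deriv lookup_psum_mult lookup_add lookup_minus lookup_single_not_eq)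
  qed
qed

text \<open>Monomials in the power sums arise from \<open>1\<close> by repeated multiplication and
  span the ring. The cases match what is known of a vertex operator: its value on \<open>1\<close>,
  its commutation with power sums, and linearity.\<close>

lemma sym_induct [case_names one psum add smult]:
  assumes one: "P 1"
    and psum: "\<And>n f. n \<ge> 1 \<Longrightarrow> P f \<Longrightarrow> P (psum n * f)"
    and add: "\<And>f g. P f \<Longrightarrow> P g \<Longrightarrow> P (f + g)"
    and smult: "\<And>c f. P f \<Longrightarrow> P (smult c f)"
  shows "P f"
proof -
  have mono: "P (Poly_Mapping.single m 1)" for m
  proof (induction "\<Sum>i\<in>Poly_Mapping.keys m. Poly_Mapping.lookup m i" arbitrary: m rule: less_induct)
    case less
    show ?case
    proof (cases "m = 0")
      case False
      then obtain i where i: "i \<in> Poly_Mapping.keys m"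
        by (metis ex_in_conv keys_eq_empty)
      then have pos: "Poly_Mapping.lookup m i > 0"
        by (simp add: in_keys_iff)
      let ?m = "m - Poly_Mapping.single i 1"
      have "Poly_Mapping.keys ?m \<subseteq> Poly_Mapping.keys m"
        by (auto simp: in_keys_iff lookup_minus)
      then have "(\<Sum>j\<in>Poly_Mapping.keys ?m. Poly_Mapping.lookup ?m j) =
          (\<Sum>j\<in>Poly_Mapping.keys m. Poly_Mapping.lookup ?m j)"
        by (intro sum.mono_neutral_left) (auto simp: in_keys_iff)
      also have "\<dots> < (\<Sum>j\<in>Poly_Mapping.keys m. Poly_Mapping.lookup m j)"
        by (rule sum_strict_mono_ex1) (use i pos in \<open>auto simp: lookup_minus intro!: bexI[of _ i]\<close>)
      finally have "P (psum (i + 1) * Poly_Mapping.single ?m 1)"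
        using less psum by simp
      then show ?thesis
        using exponent_split[OF pos] by (simp add: psum_def mult_single)
    qed (use one in simp)
  qed
  have zero: "P 0"
    using smult[OF one, of 0] by simp
  show ?thesis
  proof (induction f rule: update_induct)
    case (update f a b)
    have "Poly_Mapping.update a b f = f + smult b (Poly_Mapping.single a 1)"
      by (rule poly_mapping_eqI)
        (use update(1) in \<open>auto simp: lookup_update lookup_add lookup_single in_keys_iff\<close>)
    with update mono add smult show ?case
      by simp
  qed (rule zero)
qed

section \<open>The three exponentials of the vertex operators\<close>

definition cre_const :: "nat \<Rightarrow> qt" where
  "cre_const n = (1 - inverse t_ind ^ n) / of_nat n"

text \<open>
  The denominator \<open>n\<close> of the annihilation exponent cancels against the factor of \<open>n \<partial>/\<partial>p\<^sub>n\<close>.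
\<close>

definition ann_const :: "nat \<Rightarrow> qt" where
  "ann_const n = - (1 - q_ind ^ n)"

text \<open>The degree in the first \<open>s\<close> variables only. It may be applied to monomials
  in more variables, and then gives the remaining ones degree 0.\<close>

definition wt :: "nat \<Rightarrow> zmon \<Rightarrow> int" where
  "wt s m = (\<Sum>\<beta>=1..s. Poly_Mapping.lookup m \<beta>)"

lemma wt_add: "wt s (x + y) = wt s x + wt s y"
  by (simp add: wt_def lookup_add sum.distrib)

lemma wt_diff: "wt s (x - y) = wt s x - wt s y"
  by (simp add: wt_def lookup_minus sum_subtractf)

lemma wt_0 [simp]: "wt s 0 = 0"
  by (simp add: wt_def)

lemma wt_single: "wt s (Poly_Mapping.single i k) = (if 1 \<le> i \<and> i \<le> s then k else 0)"
  by (simp add: wt_def lookup_single when_def)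

lemma single_eq_iff:
  assumes "(k :: 'b::zero) \<noteq> 0"
  shows "Poly_Mapping.single i j = Poly_Mapping.single i' k \<longleftrightarrow> i = i' \<and> j = k"
  by (metis assms lookup_single_eq lookup_single_not_eq)

lemma sum_pos_single:
  assumes "n \<ge> 1" "\<And>k. k \<ge> 1 \<Longrightarrow> k \<noteq> n \<Longrightarrow> g k = 0"
  shows "sum_pos g = g n"
proof -
  have "g (Suc k) = (if k = n - 1 then g n else 0)" for k
    using assms by auto
  then show ?thesis
    by (simp add: sum_pos_def)
qed

lemma sum_zpow_single:
  assumes "finite A" "k \<noteq> 0"
  shows "(\<Sum>\<alpha>\<in>A. zpow \<alpha> k (Poly_Mapping.single i j)) = (if i \<in> A \<and> j = k then 1 else 0)"
proof -
  have "(\<Sum>\<alpha>\<in>A. zpow \<alpha> k (Poly_Mapping.single i j)) = (\<Sum>\<alpha>\<in>A. if i = \<alpha> then (if j = k then 1 else 0) else 0)"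
    by (rule sum.cong) (auto simp: zpow_def single_eq_iff[OF assms(2)])
  with assms show ?thesis by simp
qed

lemma op_exp_eq:
  assumes "exp_series smult S I e L w"
  shows "op_exp S m f = exp_series.E smult S f m"
proof -
  interpret exp_series smult S I e L w by fact
  have "(op_mult S ^^ k) op_one m f = iter f k m" for k m
    by (induction k arbitrary: m) (simp_all add: op_one_def op_mult_def)
  then show ?thesis
    by (simp add: op_exp_def E_def)
qed

text \<open>A scalar series acts by multiplication on the one-dimensional space \<open>qt\<close>
  and is followed on the vector \<open>1\<close>.\<close>

lemma zexp_eq:
  assumes "exp_series (*) (\<lambda>d x. F d * x) I e L w"
  shows "zexp F m = exp_series.E (*) (\<lambda>d x. F d * x) 1 m"
proof -
  interpret exp_series "(*)" "\<lambda>d x. F d * x" I e L w by fact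
  have "(zmult F ^^ k) zone m = iter 1 k m" for k m
    by (induction k arbitrary: m) (simp_all add: zone_def zmult_def)
  then show ?thesis
    by (simp add: zexp_def E_def)
qed

text \<open>In all three exponentials, a term indexed by \<open>(n, a)\<close> has weight
  \<open>n\<close>.\<close>

lemma finite_index:
  fixes w :: "nat \<times> 'a \<Rightarrow> int"
  assumes "finite A" "\<And>n a. n \<ge> 1 \<Longrightarrow> a \<in> A \<Longrightarrow> w (n, a) = int n"
  shows "{i \<in> {1..} \<times> A. w i \<le> int N} = {1..N} \<times> A"
  using assms by auto

lemma finite_index':
  fixes w :: "nat \<times> 'a \<Rightarrow> int"
  assumes "finite A" "\<And>n a. n \<ge> 1 \<Longrightarrow> a \<in> A \<Longrightarrow> w (n, a) = int n"
  shows "finite {i \<in> {1..} \<times> A. w i \<le> N}"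
proof (rule finite_subset)
  show "{i \<in> {1..} \<times> A. w i \<le> N} \<subseteq> {i \<in> {1..} \<times> A. w i \<le> int (nat N)}"
    by auto
  show "finite {i \<in> {1..} \<times> A. w i \<le> int (nat N)}"
    using assms by (subst finite_index) auto
qed

lemma wt_uminus: "wt s (- x) = - wt s x"
  using wt_diff[of s 0 x] by simp

lemma creation_exponent_single:
  assumes "n \<ge> 1" "\<alpha> \<in> {1..r}"
  shows "creation_exponent r (Poly_Mapping.single \<alpha> (int n)) f = smult (cre_const n) (psum n * f)"
proof -
  have "creation_exponent r (Poly_Mapping.single \<alpha> (int n)) f =
    smult (cre_const n * (\<Sum>\<beta>=1..r. zpow \<beta> (int n) (Poly_Mapping.single \<alpha> (int n)))) (psum n * f)"
    unfolding creation_exponent_def cre_const_def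
    by (rule sum_pos_single) (use assms in \<open>auto simp: sum_zpow_single\<close>)
  with assms show ?thesis
    by (simp add: sum_zpow_single)
qed

lemma creation_exponent_0:
  assumes "x \<notin> (\<lambda>(n, \<alpha>). Poly_Mapping.single \<alpha> (int n)) ` ({1..} \<times> {1..r})"
  shows "creation_exponent r x f = 0"
proof -
  have "zpow \<alpha> (int (Suc n)) x = 0" if "\<alpha> \<in> {1..r}" for n \<alpha>
    using assms that by (force simp: zpow_def)
  then show ?thesis
    by (simp add: creation_exponent_def sum_pos_def)
qed

lemma inj_on_single_pos:
  "inj_on (\<lambda>(n, \<alpha>). Poly_Mapping.single \<alpha> (int n)) ({1..} \<times> A)"
  by (rule inj_onI) (auto simp: single_eq_iff)

lemma inj_on_single_neg:
  "inj_on (\<lambda>(n, \<alpha>). Poly_Mapping.single \<alpha> (- int n)) ({1..} \<times> A)"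
  by (rule inj_onI) (auto simp: single_eq_iff)

interpretation cr: exp_series smult "creation_exponent r" "{1..} \<times> {1..r}"
    "\<lambda>(n, \<alpha>). Poly_Mapping.single \<alpha> (int n)" "\<lambda>(n, \<alpha>) f. smult (cre_const n) (psum n * f)" "wt r"
  for r
proof unfold_locales
  show "finite {i \<in> {1..} \<times> {1..r}. wt r (case i of (n, \<alpha>) \<Rightarrow> Poly_Mapping.single \<alpha> (int n)) \<le> N}" for N
    by (rule finite_index') (auto simp: wt_single)
  show "inj_on (\<lambda>(n, \<alpha>). Poly_Mapping.single \<alpha> (int n)) ({1..} \<times> {1..r})"
    by (rule inj_on_single_pos)
qed (auto simp: creation_exponent_single creation_exponent_0 wt_add wt_single
    sym.scale_right_distrib distrib_left smult_mult_right mult.commute mult.left_commute)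

lemma annihilation_exponent_single:
  assumes "n \<ge> 1" "\<alpha> \<in> {1..r}"
  shows "annihilation_exponent r (Poly_Mapping.single \<alpha> (- int n)) f = smult (ann_const n) (psum_deriv n f)"
proof -
  have "annihilation_exponent r (Poly_Mapping.single \<alpha> (- int n)) f =
    - smult ((1 - q_ind ^ n) / of_nat n * (\<Sum>\<beta>=1..r. zpow \<beta> (- int n) (Poly_Mapping.single \<alpha> (- int n))))
      (smult (of_nat n) (psum_deriv n f))"
    unfolding annihilation_exponent_def
    by (rule arg_cong[where f = uminus], rule sum_pos_single)
      (use assms in \<open>auto simp: sum_zpow_single\<close>)
  with assms show ?thesis
    by (simp add: sum_zpow_single ann_const_def sym.scale_left_diff_distrib)
qed

lemma annihilation_exponent_0:
  assumes "x \<notin> (\<lambda>(n, \<alpha>). Poly_Mapping.single \<alpha> (- int n)) ` ({1..} \<times> {1..r})"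
  shows "annihilation_exponent r x f = 0"
proof -
  have "zpow \<alpha> (- int (Suc n)) x = 0" if "\<alpha> \<in> {1..r}" for n \<alpha>
    using assms that by (force simp: zpow_def)
  then show ?thesis
    by (simp add: annihilation_exponent_def sum_pos_def del: of_nat_Suc)
qed

interpretation an: exp_series smult "annihilation_exponent r" "{1..} \<times> {1..r}"
    "\<lambda>(n, \<alpha>). Poly_Mapping.single \<alpha> (- int n)" "\<lambda>(n, \<alpha>) f. smult (ann_const n) (psum_deriv n f)" "\<lambda>m. - wt r m"
  for r
proof unfold_locales
  show "finite {i \<in> {1..} \<times> {1..r}. - wt r (case i of (n, \<alpha>) \<Rightarrow> Poly_Mapping.single \<alpha> (- int n)) \<le> N}" for N
    by (rule finite_index') (auto simp: wt_single)
  show "inj_on (\<lambda>(n, \<alpha>). Poly_Mapping.single \<alpha> (- int n)) ({1..} \<times> {1..r})"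
    by (rule inj_on_single_neg)
qed (auto simp: annihilation_exponent_single annihilation_exponent_0 wt_add wt_single
    sym.scale_right_distrib psum_deriv_add psum_deriv_smult psum_deriv_commute mult.commute)

section \<open>The exponent of the cross factor and its monomials\<close>

definition cross_exponent :: "nat \<Rightarrow> nat \<Rightarrow> qt zseries" where
  "cross_exponent r s = (\<lambda>m. - sum_pos (\<lambda>n.
     (1 - inverse t_ind ^ n) * (1 - q_ind ^ n) / of_nat n *
     zmult (\<lambda>d. \<Sum>\<alpha>=s+1..r+s. zpow \<alpha> (- int n) d) (\<lambda>d. \<Sum>\<beta>=1..s. zpow \<beta> (int n) d) m))"

definition cross_mon :: "nat \<times> nat \<times> nat \<Rightarrow> zmon" where
  "cross_mon = (\<lambda>(n, \<alpha>, \<beta>). Poly_Mapping.single \<beta> (int n) - Poly_Mapping.single \<alpha> (int n))"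

lemma zmult_zpow_sums:
  assumes "finite A" "finite B"
  shows "zmult (\<lambda>d. \<Sum>\<alpha>\<in>A. zpow \<alpha> j d) (\<lambda>d. \<Sum>\<beta>\<in>B. zpow \<beta> k d) m =
    (\<Sum>\<alpha>\<in>A. \<Sum>\<beta>\<in>B. if m = Poly_Mapping.single \<beta> k + Poly_Mapping.single \<alpha> j then 1 else 0)"
proof -
  have fin: "finite {d. zpow \<alpha> j d * zpow \<beta> k (m - d) \<noteq> 0}" for \<alpha> \<beta>
    by (rule finite_subset[of _ "{Poly_Mapping.single \<alpha> j}"]) (auto simp: zpow_def)
  have "zmult (\<lambda>d. \<Sum>\<alpha>\<in>A. zpow \<alpha> j d) (\<lambda>d. \<Sum>\<beta>\<in>B. zpow \<beta> k d) m =
      Sum_any (\<lambda>d. \<Sum>x\<in>A \<times> B. zpow (fst x) j d * zpow (snd x) k (m - d))"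
    by (simp add: zmult_def sum_product sum.cartesian_product case_prod_beta)
  also have "\<dots> = (\<Sum>x\<in>A \<times> B. Sum_any (\<lambda>d. zpow (fst x) j d * zpow (snd x) k (m - d)))"
    by (rule Sum_any_sum) (use assms fin in auto)
  also have "\<dots> = (\<Sum>x\<in>A \<times> B. if m = Poly_Mapping.single (snd x) k + Poly_Mapping.single (fst x) j then 1 else 0)"
  proof (rule sum.cong, rule refl)
    fix x
    have "zpow (fst x) j d * zpow (snd x) k (m - d) =
      (if d = Poly_Mapping.single (fst x) j then
        (if m = Poly_Mapping.single (snd x) k + Poly_Mapping.single (fst x) j then 1 else 0) else 0)" for d
      by (auto simp: zpow_def algebra_simps)
    then show "Sum_any (\<lambda>d. zpow (fst x) j d * zpow (snd x) k (m - d)) =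
      (if m = Poly_Mapping.single (snd x) k + Poly_Mapping.single (fst x) j then 1 else 0)"
      by simp
  qed
  finally show ?thesis
    by (simp add: sum.cartesian_product case_prod_beta)
qed

text \<open>The variables with positive and negative exponent are separated by \<open>s\<close>, so
  nothing cancels and the indices can be read off.\<close>

lemma cross_mon_eq_iff:
  assumes "n \<ge> 1" "\<beta> \<le> s" "s < \<alpha>" "\<beta>' \<le> s" "s < \<alpha>'"
  shows "cross_mon (n, \<alpha>, \<beta>) = cross_mon (n', \<alpha>', \<beta>') \<longleftrightarrow> n = n' \<and> \<alpha> = \<alpha>' \<and> \<beta> = \<beta>'"
proof
  assume eq: "cross_mon (n, \<alpha>, \<beta>) = cross_mon (n', \<alpha>', \<beta>')"
  from arg_cong[OF eq, of "\<lambda>m. Poly_Mapping.lookup m \<alpha>"] arg_cong[OF eq, of "\<lambda>m. Poly_Mapping.lookup m \<beta>"]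
  show "n = n' \<and> \<alpha> = \<alpha>' \<and> \<beta> = \<beta>'"
    using assms by (auto simp: cross_mon_def lookup_minus lookup_single when_def split: if_splits)
qed simp

lemma cross_exponent_term:
  "zmult (\<lambda>d. \<Sum>\<alpha>=s+1..r+s. zpow \<alpha> (- int n) d) (\<lambda>d. \<Sum>\<beta>=1..s. zpow \<beta> (int n) d) m =
    (\<Sum>\<alpha>=s+1..r+s. \<Sum>\<beta>=1..s. if m = cross_mon (n, \<alpha>, \<beta>) then 1 else 0)"
  by (simp add: zmult_zpow_sums cross_mon_def single_uminus)

text \<open>Only one triple contributes. The value, sign included, is the commutator of the
  annihilation term \<open>ann_const n\<close> times the derivative in \<open>p_n\<close> with the
  creation term \<open>cre_const n\<close> times \<open>p_n\<close>.\<close>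

lemma cross_exponent_mon:
  assumes n: "n \<ge> 1" and \<alpha>: "\<alpha> \<in> {s+1..r+s}" and \<beta>: "\<beta> \<in> {1..s}"
  shows "cross_exponent r s (cross_mon (n, \<alpha>, \<beta>)) = cre_const n * ann_const n"
proof -
  let ?g = "\<lambda>k. (1 - inverse t_ind ^ k) * (1 - q_ind ^ k) / of_nat k *
    (\<Sum>\<alpha>'=s+1..r+s. \<Sum>\<beta>'=1..s. if cross_mon (n, \<alpha>, \<beta>) = cross_mon (k, \<alpha>', \<beta>') then 1 else 0)"
  have inner: "(\<Sum>\<alpha>'=s+1..r+s. \<Sum>\<beta>'=1..s. if cross_mon (n, \<alpha>, \<beta>) = cross_mon (k, \<alpha>', \<beta>') then 1 else 0) =
      (if n = k then 1 else 0 :: qt)" for k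
  proof -
    have "(\<Sum>\<alpha>'=s+1..r+s. \<Sum>\<beta>'=1..s. if cross_mon (n, \<alpha>, \<beta>) = cross_mon (k, \<alpha>', \<beta>') then 1 else 0) =
        (\<Sum>\<alpha>'=s+1..r+s. \<Sum>\<beta>'=1..s. if \<alpha> = \<alpha>' then (if \<beta> = \<beta>' then (if n = k then 1 else 0 :: qt) else 0) else 0)"
      by (intro sum.cong refl) (use assms in \<open>simp add: cross_mon_eq_iff[where s = s]\<close>)
    also have "\<dots> = (\<Sum>\<alpha>'=s+1..r+s. if \<alpha> = \<alpha>' then (\<Sum>\<beta>'=1..s. (if \<beta> = \<beta>' then (if n = k then 1 else 0 :: qt) else 0)) else 0)"
      by (intro sum.cong refl) simp
    also have "\<dots> = (if n = k then 1 else 0)"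
      using \<alpha> \<beta> by simp
    finally show ?thesis .
  qed
  have g: "?g k = (if n = k then (1 - inverse t_ind ^ k) * (1 - q_ind ^ k) / of_nat k else 0)" for k
    by (subst inner) simp
  have "sum_pos ?g = ?g n"
    by (rule sum_pos_single) (use n in \<open>simp_all only: g, simp\<close>)
  then have "cross_exponent r s (cross_mon (n, \<alpha>, \<beta>)) = - ?g n"
    unfolding cross_exponent_def cross_exponent_term by (rule arg_cong)
  then show ?thesis
    by (simp only: g) (simp only: cre_const_def ann_const_def simp_thms if_True mult_minus_right times_divide_eq_left)
qed

lemma cross_exponent_0:
  assumes "x \<notin> cross_mon ` ({1..} \<times> ({s+1..r+s} \<times> {1..s}))"
  shows "cross_exponent r s x = 0"
proof -
  have "x \<noteq> cross_mon (Suc n, \<alpha>, \<beta>)" if "\<alpha> \<in> {s+1..r+s}" "\<beta> \<in> {1..s}" for n \<alpha> \<beta>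
    using assms that by force
  then have "(\<Sum>\<alpha>=s+1..r+s. \<Sum>\<beta>=1..s. if x = cross_mon (Suc n, \<alpha>, \<beta>) then 1 else 0) = (0 :: qt)" for n
    by (intro sum.neutral) simp
  then show ?thesis
    unfolding cross_exponent_def cross_exponent_term sum_pos_def by simp
qed

lemma wt_cross_mon:
  assumes "\<alpha> \<in> {s+1..r+s}" "\<beta> \<in> {1..s}"
  shows "wt s (cross_mon (n, \<alpha>, \<beta>)) = int n" "wt (r + s) (cross_mon (n, \<alpha>, \<beta>)) = 0"
  using assms by (auto simp: cross_mon_def wt_diff wt_single)

text \<open>Cross monomials have total degree 0, so the total degree cannot serve as grading. The
  degree in \<open>z_1, ..., z_s\<close> is positive on them and reflects the expansion in powers of
  \<open>z_\<beta> / z_\<alpha>\<close>.\<close>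

interpretation cx: exp_series "(*)" "\<lambda>d x. cross_exponent r s d * x" "{1..} \<times> ({s+1..r+s} \<times> {1..s})"
    cross_mon "\<lambda>(n, \<alpha>, \<beta>) x. cre_const n * ann_const n * x" "wt s"
  for r s
proof unfold_locales
  show "finite {i \<in> {1..} \<times> ({s+1..r+s} \<times> {1..s}). wt s (cross_mon i) \<le> N}" for N
    by (rule finite_index') (auto simp: wt_cross_mon(1)[where r = r])
  show "inj_on cross_mon ({1..} \<times> {s + 1..r + s} \<times> {1..s})"
    by (rule inj_onI) (auto simp: cross_mon_eq_iff[where s = s])
qed (auto simp: cross_exponent_mon cross_exponent_0 wt_add wt_cross_mon(1)[where r = r]
    distrib_left distrib_right mult.left_commute simp del: atLeastAtMost_iff)

text \<open>The creation exponential acts by multiplication with symmetric functions (see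
  \<open>creation_exp\<close>), which are recovered from its values on \<open>1\<close>.\<close>

definition creation_coeff :: "nat \<Rightarrow> zmon \<Rightarrow> sym" where
  "creation_coeff r m = op_exp (creation_exponent r) m 1"

definition annih_coeff :: "nat \<Rightarrow> zmon \<Rightarrow> sym \<Rightarrow> sym" where
  "annih_coeff r m f = op_exp (annihilation_exponent r) m f"

lemma creation_coeff_eq: "creation_coeff r m = cr.E r 1 m"
  unfolding creation_coeff_def by (rule op_exp_eq[OF cr.exp_series_axioms])

lemma annih_coeff_eq: "annih_coeff r m f = an.E r f m"
  unfolding annih_coeff_def by (rule op_exp_eq[OF an.exp_series_axioms])

lemma cross_factor_eq: "cross_factor r s m = cx.E r s 1 m"
  unfolding cross_factor_def cross_exponent_def[symmetric]
  by (rule zexp_eq[OF cx.exp_series_axioms])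

lemma cr_J: "cr.J r (int N) = {1..N} \<times> {1..r}"
  unfolding cr.J_def by (rule finite_index) (auto simp: wt_single)

lemma an_J: "an.J r (int N) = {1..N} \<times> {1..r}"
  unfolding an.J_def by (rule finite_index) (auto simp: wt_single)

lemma cx_J: "cx.J s r (int N) = {1..N} \<times> {s+1..r+s} \<times> {1..s}"
  unfolding cx.J_def by (rule finite_index) (auto simp: wt_cross_mon(1)[where r = r])

text \<open>Multiplication by \<open>f\<close> commutes with the terms of the exponent, so both
  sides solve the Euler recurrence with initial vector \<open>f\<close>.\<close>

lemma creation_exp: "op_exp (creation_exponent r) m f = creation_coeff r m * f"
proof -
  have "cr.E r f m = creation_coeff r m * f"
  proof (rule cr.euler_unique[where r = r and F = "\<lambda>m. cr.E r f m"])
    fix m show "cr.E r f m = creation_coeff r m * f" if "wt r m \<le> 0"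
      using that by (simp add: creation_coeff_eq cr.E_low)
    show "smult (of_int (wt r m)) (cr.E r f m) =
      (\<Sum>i\<in>cr.J r (wt r m). smult (of_int (wt r (case i of (n, \<alpha>) \<Rightarrow> Poly_Mapping.single \<alpha> (int n))))
        ((case i of (n, \<alpha>) \<Rightarrow> \<lambda>f. smult (cre_const n) (psum n * f))
          (cr.E r f (m - (case i of (n, \<alpha>) \<Rightarrow> Poly_Mapping.single \<alpha> (int n))))))"
      by (rule cr.E_euler) (simp_all add: wt_add)
    have "smult (of_int (wt r m)) (creation_coeff r m * f) = smult (of_int (wt r m)) (creation_coeff r m) * f"
      by (simp only: smult_mult_left)
    also have "\<dots> = (\<Sum>i\<in>cr.J r (wt r m). smult (of_int (wt r (case i of (n, \<alpha>) \<Rightarrow> Poly_Mapping.single \<alpha> (int n))))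
        ((case i of (n, \<alpha>) \<Rightarrow> \<lambda>f. smult (cre_const n) (psum n * f))
          (creation_coeff r (m - (case i of (n, \<alpha>) \<Rightarrow> Poly_Mapping.single \<alpha> (int n))) * f)))"
      unfolding creation_coeff_eq cr.E_euler[where u = "wt r", OF wt_add order_refl] sum_distrib_right
      by (rule sum.cong) (auto simp: smult_mult_left mult.assoc)
    finally show "smult (of_int (wt r m)) (creation_coeff r m * f) = \<dots>" .
  qed
  then show ?thesis
    by (simp only: op_exp_eq[OF cr.exp_series_axioms])
qed

lemma creation_coeff_support:
  assumes "creation_coeff r m \<noteq> 0"
  shows "Poly_Mapping.keys m \<subseteq> {1..r}" "Poly_Mapping.lookup m i \<ge> 0"
proof -
  have "Poly_Mapping.keys m \<subseteq> {1..r} \<and> (\<forall>i. Poly_Mapping.lookup m i \<ge> 0)"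
  proof (rule cr.E_support[where r = r])
    fix m :: zmon and i :: "nat \<times> nat"
    assume m: "Poly_Mapping.keys m \<subseteq> {1..r} \<and> (\<forall>i. Poly_Mapping.lookup m i \<ge> 0)"
      and i: "i \<in> {1..} \<times> {1..r}"
    then obtain n \<alpha> where "i = (n, \<alpha>)" "\<alpha> \<in> {1..r}" by auto
    with m keys_add[of m "Poly_Mapping.single \<alpha> (int n)"]
    show "Poly_Mapping.keys (m + (case i of (n, \<alpha>) \<Rightarrow> Poly_Mapping.single \<alpha> (int n))) \<subseteq> {1..r} \<and>
      (\<forall>j. Poly_Mapping.lookup (m + (case i of (n, \<alpha>) \<Rightarrow> Poly_Mapping.single \<alpha> (int n))) j \<ge> 0)"
      by (auto simp: lookup_add lookup_single when_def split: if_splits)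
  qed (use assms in \<open>auto simp: creation_coeff_eq\<close>)
  then show "Poly_Mapping.keys m \<subseteq> {1..r}" "Poly_Mapping.lookup m i \<ge> 0"
    by auto
qed

text \<open>As \<open>u\<close> is free, the derivation may act on part of the variables: below it
  is also \<open>wt s\<close> on a series in \<open>r + s\<close> variables.\<close>

lemma creation_coeff_euler:
  fixes u :: "zmon \<Rightarrow> int"
  assumes "\<And>x y. u (x + y) = u x + u y" "wt r m \<le> int N"
  shows "smult (of_int (u m)) (creation_coeff r m) = (\<Sum>n=1..N. \<Sum>\<alpha>=1..r.
    smult (of_int (u (Poly_Mapping.single \<alpha> (int n))) * cre_const n)
      (psum n * creation_coeff r (m - Poly_Mapping.single \<alpha> (int n))))"
  using cr.E_euler[OF assms(1) assms(2), of 1]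
  unfolding creation_coeff_eq cr_J sum.cartesian_product case_prod_beta by simp

lemma annih_coeff_low: "wt r m \<ge> 0 \<Longrightarrow> annih_coeff r m f = (if m = 0 then f else 0)"
  using an.E_low[of r m f] by (simp add: annih_coeff_eq)

lemma annih_coeff_add: "annih_coeff r m (f + g) = annih_coeff r m f + annih_coeff r m g"
  by (simp add: annih_coeff_eq an.E_add)

lemma annih_coeff_smult: "annih_coeff r m (smult c f) = smult c (annih_coeff r m f)"
  by (simp add: annih_coeff_eq an.E_scale)

lemma annih_coeff_euler:
  "- wt r m \<le> int N \<Longrightarrow> smult (of_int (- wt r m)) (annih_coeff r m f) = (\<Sum>n=1..N. \<Sum>\<alpha>=1..r.
    smult (of_nat n * ann_const n) (psum_deriv n (annih_coeff r (m + Poly_Mapping.single \<alpha> (int n)) f)))"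
proof -
  assume N: "- wt r m \<le> int N"
  have "smult (of_int (- wt r m)) (annih_coeff r m f) = (\<Sum>i\<in>{1..N} \<times> {1..r}.
      smult (of_nat (fst i) * ann_const (fst i))
        (psum_deriv (fst i) (annih_coeff r (m + Poly_Mapping.single (snd i) (int (fst i))) f)))"
    unfolding annih_coeff_eq an.E_euler[where u = "\<lambda>m. - wt r m", OF an.w_add N] an_J
    by (rule sum.cong) (auto simp: wt_single single_uminus wt_uminus)
  then show ?thesis
    by (simp add: sum.cartesian_product case_prod_beta)
qed

lemma cross_factor_0: "cross_factor r s 0 = 1"
  by (simp add: cross_factor_eq cx.E_low)

lemma cross_factor_low: "wt s c \<le> 0 \<Longrightarrow> cross_factor r s c = (if c = 0 then 1 else 0)"
  by (simp add: cross_factor_eq cx.E_low)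

text \<open>Invariants of products of monomials \<open>z_\<beta>^n / z_\<alpha>^n\<close> with
  \<open>\<beta> \<le> s < \<alpha>\<close>.\<close>

lemma cross_factor_support:
  assumes "cross_factor r s c \<noteq> 0"
  shows "Poly_Mapping.keys c \<subseteq> {1..r+s}" "i \<le> s \<Longrightarrow> Poly_Mapping.lookup c i \<ge> 0"
    "i > s \<Longrightarrow> Poly_Mapping.lookup c i \<le> 0" "wt (r + s) c = 0"
proof -
  let ?P = "\<lambda>c. Poly_Mapping.keys c \<subseteq> {1..r+s} \<and> (\<forall>i\<le>s. Poly_Mapping.lookup c i \<ge> 0) \<and>
    (\<forall>i>s. Poly_Mapping.lookup c i \<le> 0) \<and> wt (r + s) c = 0"
  have "?P c"
  proof (rule cx.E_support[where r = r and s = s and P = ?P])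
    fix m :: zmon and i :: "nat \<times> nat \<times> nat"
    assume m: "?P m" and i: "i \<in> {1..} \<times> {s+1..r+s} \<times> {1..s}"
    then obtain n \<alpha> \<beta> where i: "i = (n, \<alpha>, \<beta>)" "\<alpha> \<in> {s+1..r+s}" "\<beta> \<in> {1..s}" by auto
    have "Poly_Mapping.keys (m + cross_mon i) \<subseteq> Poly_Mapping.keys m \<union> {\<alpha>, \<beta>}"
      using i by (auto simp: in_keys_iff cross_mon_def lookup_add lookup_minus lookup_single when_def split: if_splits)
    with m i(2,3) have "Poly_Mapping.keys (m + cross_mon i) \<subseteq> {1..r+s}"
      by auto
    moreover have "wt (r + s) (m + cross_mon i) = 0"
      using m i wt_cross_mon(2)[OF i(2,3)] by (simp add: wt_add)
    moreover have "Poly_Mapping.lookup m \<alpha> \<le> 0"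
      using m i by auto
    then have "Poly_Mapping.lookup m \<alpha> \<le> int n"
      by simp
    ultimately show "?P (m + cross_mon i)"
      using m i by (auto simp: cross_mon_def lookup_add lookup_minus lookup_single when_def)
  qed (use assms in \<open>auto simp: cross_factor_eq\<close>)
  then show "Poly_Mapping.keys c \<subseteq> {1..r+s}" "i \<le> s \<Longrightarrow> Poly_Mapping.lookup c i \<ge> 0"
    "i > s \<Longrightarrow> Poly_Mapping.lookup c i \<le> 0" "wt (r + s) c = 0"
    by auto
qed

lemma cross_factor_euler:
  assumes "wt s c \<le> int N"
  shows "of_int (wt s c) * cross_factor r s c = (\<Sum>n=1..N. \<Sum>\<alpha>=s+1..r+s. \<Sum>\<beta>=1..s.
    of_nat n * cre_const n * ann_const n * cross_factor r s (c - cross_mon (n, \<alpha>, \<beta>)))"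
proof -
  have "of_int (wt s c) * cross_factor r s c = (\<Sum>i\<in>{1..N} \<times> {s+1..r+s} \<times> {1..s}.
      of_nat (fst i) * cre_const (fst i) * ann_const (fst i) * cross_factor r s (c - cross_mon i))"
    unfolding cross_factor_eq cx.E_euler[where u = "wt s", OF wt_add assms] cx_J
  proof (rule sum.cong, rule refl)
    fix i assume "i \<in> {1..N} \<times> {s+1..r+s} \<times> {1..s}"
    then obtain n \<alpha> \<beta> where i: "i = (n, \<alpha>, \<beta>)" "\<alpha> \<in> {s+1..r+s}" "\<beta> \<in> {1..s}"
      by auto
    show "of_int (wt s (cross_mon i)) * ((case i of (n, \<alpha>, \<beta>) \<Rightarrow> \<lambda>x. cre_const n * ann_const n * x)
        (cx.E r s 1 (c - cross_mon i))) =
      of_nat (fst i) * cre_const (fst i) * ann_const (fst i) * cx.E r s 1 (c - cross_mon i)"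
      unfolding i(1) wt_cross_mon(1)[OF i(2,3)] prod.case fst_conv of_int_of_nat_eq mult.assoc ..
  qed
  then show ?thesis
    by (simp add: sum.cartesian_product case_prod_beta)
qed

section \<open>Coefficients of the vertex operators\<close>

lemma Sum_any_hom:
  assumes "\<And>x y. h (x + y) = h x + h y" "h 0 = 0" "finite {x. g x \<noteq> 0}"
  shows "h (Sum_any g) = Sum_any (\<lambda>x. h (g x))"
proof -
  have "h (sum g X) = (\<Sum>x\<in>X. h (g x))" for X
    by (induction X rule: infinite_finite_induct) (simp_all add: assms)
  moreover have "Sum_any (\<lambda>x. h (g x)) = (\<Sum>x | g x \<noteq> 0. h (g x))"
    by (rule Sum_any.expand_superset) (use assms in auto)
  ultimately show ?thesis
    by (simp add: Sum_any.expand_set)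
qed

lemma finite_box:
  assumes "finite A"
  shows "finite {m :: zmon. Poly_Mapping.keys m \<subseteq> A \<and>
    (\<forall>i\<in>A. l i \<le> Poly_Mapping.lookup m i \<and> Poly_Mapping.lookup m i \<le> u i)}" (is "finite ?S")
proof (rule finite_imageD)
  have "(\<lambda>m. restrict (Poly_Mapping.lookup m) A) ` ?S \<subseteq> PiE A (\<lambda>i. {l i..u i})"
    by auto
  then show "finite ((\<lambda>m. restrict (Poly_Mapping.lookup m) A) ` ?S)"
    by (rule finite_subset) (auto intro!: finite_PiE assms)
  show "inj_on (\<lambda>m. restrict (Poly_Mapping.lookup m) A) ?S"
  proof (rule inj_onI)
    fix x y assume x: "x \<in> ?S" and y: "y \<in> ?S"
      and eq: "restrict (Poly_Mapping.lookup x) A = restrict (Poly_Mapping.lookup y) A"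
    show "x = y"
    proof (rule poly_mapping_eqI)
      fix i
      show "Poly_Mapping.lookup x i = Poly_Mapping.lookup y i"
      proof (cases "i \<in> A")
        case True
        with fun_cong[OF eq, of i] show ?thesis by simp
      next
        case False
        with x y have "i \<notin> Poly_Mapping.keys x" "i \<notin> Poly_Mapping.keys y" by auto
        then show ?thesis by (simp add: in_keys_iff)
      qed
    qed
  qed
qed

lemma psum_deriv_0: "psum_deriv n 0 = 0"
  by (simp add: psum_deriv_def)

lemma psum_deriv_sum: "psum_deriv n (\<Sum>x\<in>X. g x) = (\<Sum>x\<in>X. psum_deriv n (g x))"
  by (induction X rule: infinite_finite_induct) (simp_all add: psum_deriv_0 psum_deriv_add)

lemma annih_coeff_one: "annih_coeff r m 1 = (if m = 0 then 1 else 0)"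
proof (induction "nat (- wt r m)" arbitrary: m rule: less_induct)
  case less
  show ?case
  proof (cases "wt r m \<ge> 0")
    case False
    define N where "N = nat (- wt r m)"
    have N: "- wt r m \<le> int N"
      by (simp add: N_def)
    have "smult (of_int (- wt r m)) (annih_coeff r m 1) = (\<Sum>n=1..N. \<Sum>\<alpha>=1..r. 0)"
      unfolding annih_coeff_euler[OF N]
    proof (intro sum.cong refl)
      fix n \<alpha> assume "n \<in> {1..N}" "\<alpha> \<in> {1..r}"
      \<comment> \<open>Either value is a constant, which the derivative kills.\<close>
      then have "annih_coeff r (m + Poly_Mapping.single \<alpha> (int n)) 1 \<in> {0, 1}"
        using less[of "m + Poly_Mapping.single \<alpha> (int n)"] False
        by (auto simp: wt_add wt_single split: if_splits)
      then show "smult (of_nat n * ann_const n) (psum_deriv n (annih_coeff r (m + Poly_Mapping.single \<alpha> (int n)) 1)) = 0"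
        by (auto simp: psum_deriv_0 psum_deriv_one)
    qed
    then have "annih_coeff r m 1 = 0"
      using False by simp
    with False show ?thesis by auto
  qed (rule annih_coeff_low)
qed

text \<open>Coefficient form of \<open>exp(D) p_n = (p_n + [D, p_n]) exp(D)\<close>, valid since
  \<open>[D, p_n]\<close> is a scalar series: \<open>ann_const n\<close> times the sum of the
  \<open>z_\<alpha>^(-n)\<close>. The right side is shown to satisfy the Euler recurrence of the
  left.\<close>

lemma annih_coeff_psum:
  assumes n: "n \<ge> 1"
  shows "annih_coeff r m (psum n * f) = psum n * annih_coeff r m f +
    smult (ann_const n) (\<Sum>\<alpha>=1..r. annih_coeff r (m + Poly_Mapping.single \<alpha> (int n)) f)"
proof (induction "nat (- wt r m)" arbitrary: m rule: less_induct)
  case less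
  let ?F = "\<lambda>m. psum n * annih_coeff r m f +
    smult (ann_const n) (\<Sum>\<alpha>=1..r. annih_coeff r (m + Poly_Mapping.single \<alpha> (int n)) f)"
  show ?case
  proof (cases "wt r m \<ge> 0")
    case True
    have "annih_coeff r (m + Poly_Mapping.single \<alpha> (int n)) f = 0" if "\<alpha> \<in> {1..r}" for \<alpha>
    proof -
      have "wt r (m + Poly_Mapping.single \<alpha> (int n)) > 0"
        using True n that by (simp add: wt_add wt_single)
      then show ?thesis
        by (subst annih_coeff_low) auto
    qed
    with True show ?thesis
      by (simp add: annih_coeff_low)
  next
    case False
    \<comment> \<open>Besides covering the degree, \<open>N\<close> reaches \<open>n\<close>, so
      that the index \<open>k = n\<close> of the commutator lies in the range.\<close>
    define N where "N = max (nat (- wt r m)) n"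
    have N: "- wt r m \<le> int N" "n \<in> {1..N}"
      using n by (auto simp: N_def)
    let ?e = "\<lambda>\<alpha> k. Poly_Mapping.single \<alpha> (int k)"
    have "smult (of_int (- wt r m)) (annih_coeff r m (psum n * f)) = (\<Sum>k=1..N. \<Sum>\<alpha>=1..r.
        smult (of_nat k * ann_const k) (psum_deriv k (?F (m + ?e \<alpha> k))))"
      unfolding annih_coeff_euler[OF N(1)]
    proof (intro sum.cong refl)
      fix k \<alpha> assume "k \<in> {1..N}" "\<alpha> \<in> {1..r}"
      then have "annih_coeff r (m + ?e \<alpha> k) (psum n * f) = ?F (m + ?e \<alpha> k)"
        using False by (intro less) (simp add: wt_add wt_single)
      then show "smult (of_nat k * ann_const k) (psum_deriv k (annih_coeff r (m + ?e \<alpha> k) (psum n * f))) =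
        smult (of_nat k * ann_const k) (psum_deriv k (?F (m + ?e \<alpha> k)))"
        by simp
    qed
    also have "\<dots> = (\<Sum>k=1..N. \<Sum>\<alpha>=1..r.
        psum n * smult (of_nat k * ann_const k) (psum_deriv k (annih_coeff r (m + ?e \<alpha> k) f)) +
        ((if k = n then smult (of_nat k * ann_const k) (annih_coeff r (m + ?e \<alpha> k) f) else 0) +
        (\<Sum>\<beta>=1..r. smult (ann_const n) (smult (of_nat k * ann_const k)
           (psum_deriv k (annih_coeff r (m + ?e \<beta> n + ?e \<alpha> k) f))))))"
    proof (intro sum.cong refl)
      fix k \<alpha> assume k: "k \<in> {1..N}"
      let ?c = "of_nat k * ann_const k" and ?X = "annih_coeff r (m + ?e \<alpha> k) f"
      have c: "m + ?e \<alpha> k + ?e \<beta> n = m + ?e \<beta> n + ?e \<alpha> k" for \<beta>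
        by (simp only: ac_simps)
      have "smult ?c (psum_deriv k (?F (m + ?e \<alpha> k))) =
          smult ?c (psum n * psum_deriv k ?X) + smult ?c (if k = n then ?X else 0) +
          (\<Sum>\<beta>=1..r. smult ?c (smult (ann_const n) (psum_deriv k (annih_coeff r (m + ?e \<beta> n + ?e \<alpha> k) f))))"
        using k by (simp only: c psum_deriv_add psum_deriv_smult psum_deriv_sum psum_deriv_psum_mult[OF n]
          atLeastAtMost_iff sym.scale_right_distrib sym.scale_sum_right)
      moreover have "smult ?c (if k = n then ?X else 0) = (if k = n then smult ?c ?X else 0)"
        by simp
      ultimately show "smult ?c (psum_deriv k (?F (m + ?e \<alpha> k))) =
          psum n * smult ?c (psum_deriv k ?X) + ((if k = n then smult ?c ?X else 0) +
          (\<Sum>\<beta>=1..r. smult (ann_const n) (smult ?c (psum_deriv k (annih_coeff r (m + ?e \<beta> n + ?e \<alpha> k) f)))))"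
        by (simp only: smult_mult_right add.assoc sym.scale_left_commute)
    qed
    also have "\<dots> = psum n * (\<Sum>k=1..N. \<Sum>\<alpha>=1..r. smult (of_nat k * ann_const k) (psum_deriv k (annih_coeff r (m + ?e \<alpha> k) f))) +
        ((\<Sum>k=1..N. \<Sum>\<alpha>=1..r. if k = n then smult (of_nat k * ann_const k) (annih_coeff r (m + ?e \<alpha> k) f) else 0) +
        (\<Sum>k=1..N. \<Sum>\<alpha>=1..r. \<Sum>\<beta>=1..r. smult (ann_const n) (smult (of_nat k * ann_const k)
           (psum_deriv k (annih_coeff r (m + ?e \<beta> n + ?e \<alpha> k) f)))))"
      by (simp only: sum.distrib sum_distrib_left)
    also have "(\<Sum>k=1..N. \<Sum>\<alpha>=1..r. if k = n then smult (of_nat k * ann_const k) (annih_coeff r (m + ?e \<alpha> k) f) else 0) =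
        (\<Sum>\<alpha>=1..r. smult (of_nat n * ann_const n) (annih_coeff r (m + ?e \<alpha> n) f))"
      using N(2) by (subst sum.swap) simp
    also have "(\<Sum>k=1..N. \<Sum>\<alpha>=1..r. \<Sum>\<beta>=1..r. smult (ann_const n) (smult (of_nat k * ann_const k)
           (psum_deriv k (annih_coeff r (m + ?e \<beta> n + ?e \<alpha> k) f)))) =
        (\<Sum>\<beta>=1..r. smult (ann_const n) (\<Sum>k=1..N. \<Sum>\<alpha>=1..r. smult (of_nat k * ann_const k)
           (psum_deriv k (annih_coeff r (m + ?e \<beta> n + ?e \<alpha> k) f))))"
      unfolding sym.scale_sum_right
      by (subst sum.swap, subst (2) sum.swap) (simp only: sum.swap[of _ "{1..r}" "{1..N}"])
    also have "\<dots> = (\<Sum>\<beta>=1..r. smult (ann_const n) (smult (of_int (- wt r m - int n)) (annih_coeff r (m + ?e \<beta> n) f)))"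
    proof (intro sum.cong refl arg_cong[where f = "smult (ann_const n)"])
      fix \<beta> assume "\<beta> \<in> {1..r}"
      then have w: "- wt r (m + ?e \<beta> n) = - wt r m - int n"
        by (simp add: wt_add wt_single)
      then have "- wt r (m + ?e \<beta> n) \<le> int N"
        using N by simp
      from annih_coeff_euler[OF this, of f, unfolded w]
      show "(\<Sum>k=1..N. \<Sum>\<alpha>=1..r. smult (of_nat k * ann_const k)
           (psum_deriv k (annih_coeff r (m + ?e \<beta> n + ?e \<alpha> k) f))) =
         smult (of_int (- wt r m - int n)) (annih_coeff r (m + ?e \<beta> n) f)" ..
    qed
    also have "(\<Sum>\<alpha>=1..r. smult (of_nat n * ann_const n) (annih_coeff r (m + ?e \<alpha> n) f)) + \<dots> =
        (\<Sum>\<alpha>=1..r. smult (of_int (- wt r m)) (smult (ann_const n) (annih_coeff r (m + ?e \<alpha> n) f)))"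
      unfolding sum.distrib[symmetric]
    proof (intro sum.cong refl)
      fix \<alpha>
      \<comment> \<open>Product rule for \<open>z_\<alpha>^(-n)\<close>: its negated degree
        \<open>n\<close> and that of the shifted coefficient add up to the negated degree of
        \<open>m\<close>.\<close>
      have "of_nat n * ann_const n + ann_const n * of_int (- wt r m - int n) = of_int (- wt r m) * ann_const n"
        by (simp add: ring_distribs mult.commute)
      then show "smult (of_nat n * ann_const n) (annih_coeff r (m + ?e \<alpha> n) f) +
          smult (ann_const n) (smult (of_int (- wt r m - int n)) (annih_coeff r (m + ?e \<alpha> n) f)) =
        smult (of_int (- wt r m)) (smult (ann_const n) (annih_coeff r (m + ?e \<alpha> n) f))"
        unfolding sym.scale_scale sym.scale_left_distrib[symmetric] by (rule arg_cong)
    qed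
    also have "psum n * (\<Sum>k=1..N. \<Sum>\<alpha>=1..r. smult (of_nat k * ann_const k) (psum_deriv k (annih_coeff r (m + ?e \<alpha> k) f))) +
        \<dots> = smult (of_int (- wt r m)) (?F m)"
      by (simp only: annih_coeff_euler[OF N(1), symmetric] sym.scale_right_distrib sym.scale_sum_right
          smult_mult_right)
    finally show ?thesis
      using False by (auto dest: sym.scale_left_imp_eq[rotated])
  qed
qed

lemma annih_coeff_support:
  assumes "annih_coeff r m f \<noteq> 0"
  shows "Poly_Mapping.keys m \<subseteq> {1..r}" "Poly_Mapping.lookup m i \<le> 0"
proof -
  have "Poly_Mapping.keys m \<subseteq> {1..r} \<and> (\<forall>i. Poly_Mapping.lookup m i \<le> 0)"
  proof (rule an.E_support[where r = r])
    fix m :: zmon and i :: "nat \<times> nat"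
    assume m: "Poly_Mapping.keys m \<subseteq> {1..r} \<and> (\<forall>i. Poly_Mapping.lookup m i \<le> 0)"
      and i: "i \<in> {1..} \<times> {1..r}"
    then obtain n \<alpha> where "i = (n, \<alpha>)" "\<alpha> \<in> {1..r}" by auto
    moreover have "Poly_Mapping.lookup m \<alpha> \<le> int n"
      using m by (meson of_nat_0_le_iff order_trans)
    moreover note m keys_add[of m "Poly_Mapping.single \<alpha> (- int n)"]
    ultimately
    show "Poly_Mapping.keys (m + (case i of (n, \<alpha>) \<Rightarrow> Poly_Mapping.single \<alpha> (- int n))) \<subseteq> {1..r} \<and>
      (\<forall>j. Poly_Mapping.lookup (m + (case i of (n, \<alpha>) \<Rightarrow> Poly_Mapping.single \<alpha> (- int n))) j \<le> 0)"
      by (auto simp: lookup_add lookup_single when_def split: if_splits)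
  qed (use assms in \<open>auto simp: annih_coeff_eq\<close>)
  then show "Poly_Mapping.keys m \<subseteq> {1..r}" "Poly_Mapping.lookup m i \<le> 0"
    by auto
qed

text \<open>A fixed polynomial survives only finitely many derivatives. Multiplying it by
  \<open>p_n\<close> lowers the bound by at most \<open>n\<close>, through the shift in
  \<open>annih_coeff_psum\<close>.\<close>

lemma annih_coeff_bounded_below: "\<exists>D::nat. \<forall>m i. annih_coeff r m f \<noteq> 0 \<longrightarrow> - int D \<le> Poly_Mapping.lookup m i"
proof (induction f rule: sym_induct)
  case one
  show ?case by (rule exI[of _ 0]) (auto simp: annih_coeff_one)
next
  case (psum n f)
  then obtain D where D: "\<And>m i. annih_coeff r m f \<noteq> 0 \<Longrightarrow> - int D \<le> Poly_Mapping.lookup m i"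
    by blast
  show ?case
  proof (intro exI[of _ "D + n"] allI impI)
    fix m i
    assume "annih_coeff r m (psum n * f) \<noteq> 0"
    then have "annih_coeff r m f \<noteq> 0 \<or> (\<Sum>\<alpha>=1..r. annih_coeff r (m + Poly_Mapping.single \<alpha> (int n)) f) \<noteq> 0"
      using psum(1) by (auto simp: annih_coeff_psum)
    then show "- int (D + n) \<le> Poly_Mapping.lookup m i"
    proof
      assume "annih_coeff r m f \<noteq> 0"
      from D[OF this, of i] show ?thesis by simp
    next
      assume "(\<Sum>\<alpha>=1..r. annih_coeff r (m + Poly_Mapping.single \<alpha> (int n)) f) \<noteq> 0"
      then obtain \<alpha> where "annih_coeff r (m + Poly_Mapping.single \<alpha> (int n)) f \<noteq> 0"
        by (meson sum.not_neutral_contains_not_neutral)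
      from D[OF this, of i] show ?thesis
        by (auto simp: lookup_add lookup_single when_def split: if_splits)
    qed
  qed
next
  case (add f g)
  then obtain D D' where D: "\<And>m i. annih_coeff r m f \<noteq> 0 \<Longrightarrow> - int D \<le> Poly_Mapping.lookup m i"
      "\<And>m i. annih_coeff r m g \<noteq> 0 \<Longrightarrow> - int D' \<le> Poly_Mapping.lookup m i"
    by blast
  show ?case
  proof (intro exI[of _ "D + D'"] allI impI)
    fix m i
    assume "annih_coeff r m (f + g) \<noteq> 0"
    then have "annih_coeff r m f \<noteq> 0 \<or> annih_coeff r m g \<noteq> 0"
      by (auto simp: annih_coeff_add)
    with D[of m i] show "- int (D + D') \<le> Poly_Mapping.lookup m i"
      by auto
  qed
next
  case (smult c f)
  then show ?case
    by (auto simp: annih_coeff_smult)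
qed

definition vertex_coeff :: "nat \<Rightarrow> zmon \<Rightarrow> sym \<Rightarrow> sym" where
  "vertex_coeff r m f = Sum_any (\<lambda>d. creation_coeff r d * annih_coeff r (m - d) f)"

lemma op_mult_vertex_coeff: "op_mult (op_exp (creation_exponent r)) (op_exp (annihilation_exponent r)) m f = vertex_coeff r m f"
  by (simp add: op_mult_def vertex_coeff_def creation_exp annih_coeff_def)

text \<open>Creation exponents are nonnegative and annihilation exponents are bounded below on
  \<open>f\<close>, which confines \<open>d\<close> to a box.\<close>

lemma finite_vertex_coeff: "finite {d. creation_coeff r d * annih_coeff r (m - d) f \<noteq> 0}"
proof -
  obtain D where D: "\<And>m i. annih_coeff r m f \<noteq> 0 \<Longrightarrow> - int D \<le> Poly_Mapping.lookup m i"
    using annih_coeff_bounded_below by blast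
  show ?thesis
  proof (rule finite_subset)
    show "{d. creation_coeff r d * annih_coeff r (m - d) f \<noteq> 0} \<subseteq> {d. Poly_Mapping.keys d \<subseteq> {1..r} \<and>
      (\<forall>i\<in>{1..r}. 0 \<le> Poly_Mapping.lookup d i \<and> Poly_Mapping.lookup d i \<le> Poly_Mapping.lookup m i + int D)}"
    proof safe
      fix d i assume nz: "creation_coeff r d * annih_coeff r (m - d) f \<noteq> 0"
      then have h: "creation_coeff r d \<noteq> 0" and e: "annih_coeff r (m - d) f \<noteq> 0" by auto
      show "i \<in> {1..r}" if "i \<in> Poly_Mapping.keys d"
        using creation_coeff_support(1)[OF h] that by blast
      show "0 \<le> Poly_Mapping.lookup d i"
        by (rule creation_coeff_support(2)[OF h])
      show "Poly_Mapping.lookup d i \<le> Poly_Mapping.lookup m i + int D"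
        using D[OF e, of i] by (simp add: lookup_minus)
    qed
  qed (rule finite_box, simp)
qed

lemma vertex_coeff_add: "vertex_coeff r m (f + g) = vertex_coeff r m f + vertex_coeff r m g"
  unfolding vertex_coeff_def annih_coeff_add distrib_left by (rule Sum_any.distrib) (rule finite_vertex_coeff)+

lemma vertex_coeff_smult: "vertex_coeff r m (smult c f) = smult c (vertex_coeff r m f)"
  unfolding vertex_coeff_def
  by (subst Sum_any_hom[where h = "smult c"])
    (simp_all add: sym.scale_right_distrib finite_vertex_coeff annih_coeff_smult smult_mult_right del: mult_eq_0_iff)

lemma vertex_coeff_0: "vertex_coeff r m 0 = 0"
  using vertex_coeff_smult[of r m 0 0] by simp

lemma vertex_coeff_one: "vertex_coeff r m 1 = creation_coeff r m"
proof -
  have "creation_coeff r d * annih_coeff r (m - d) 1 = (if d = m then creation_coeff r d else 0)" for d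
    by (simp add: annih_coeff_one)
  then show ?thesis by (simp add: vertex_coeff_def)
qed

text \<open>Creation coefficients are multiplications and commute with \<open>p_n\<close>; the extra
  term comes from the annihilation part alone.\<close>

lemma vertex_coeff_psum:
  assumes n: "n \<ge> 1"
  shows "vertex_coeff r m (psum n * f) = psum n * vertex_coeff r m f +
    smult (ann_const n) (\<Sum>\<alpha>=1..r. vertex_coeff r (m + Poly_Mapping.single \<alpha> (int n)) f)"
proof -
  let ?e = "\<lambda>\<alpha>. Poly_Mapping.single \<alpha> (int n)"
  have "vertex_coeff r m (psum n * f) = Sum_any (\<lambda>d. psum n * (creation_coeff r d * annih_coeff r (m - d) f) +
      (\<Sum>\<alpha>=1..r. smult (ann_const n) (creation_coeff r d * annih_coeff r (m + ?e \<alpha> - d) f)))"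
    unfolding vertex_coeff_def annih_coeff_psum[OF n]
    by (simp add: distrib_left mult.left_commute smult_mult_right sum_distrib_left sym.scale_sum_right
        add_diff_eq diff_add_eq)
  also have "\<dots> = Sum_any (\<lambda>d. psum n * (creation_coeff r d * annih_coeff r (m - d) f)) +
      Sum_any (\<lambda>d. \<Sum>\<alpha>=1..r. smult (ann_const n) (creation_coeff r d * annih_coeff r (m + ?e \<alpha> - d) f))"
  proof (rule Sum_any.distrib)
    show "finite {d. psum n * (creation_coeff r d * annih_coeff r (m - d) f) \<noteq> 0}"
      by (rule finite_subset[OF _ finite_vertex_coeff[of r m f]]) auto
    show "finite {d. (\<Sum>\<alpha>=1..r. smult (ann_const n) (creation_coeff r d * annih_coeff r (m + ?e \<alpha> - d) f)) \<noteq> 0}"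
    proof (rule finite_subset)
      show "finite (\<Union>\<alpha>\<in>{1..r}. {d. creation_coeff r d * annih_coeff r (m + ?e \<alpha> - d) f \<noteq> 0})"
        by (intro finite_UN_I finite_atLeastAtMost finite_vertex_coeff)
    qed (auto elim!: sum.not_neutral_contains_not_neutral simp del: mult_eq_0_iff)
  qed
  also have "Sum_any (\<lambda>d. psum n * (creation_coeff r d * annih_coeff r (m - d) f)) = psum n * vertex_coeff r m f"
    unfolding vertex_coeff_def by (rule Sum_any_right_distrib[OF finite_vertex_coeff, symmetric])
  also have "Sum_any (\<lambda>d. \<Sum>\<alpha>=1..r. smult (ann_const n) (creation_coeff r d * annih_coeff r (m + ?e \<alpha> - d) f)) =
      (\<Sum>\<alpha>=1..r. Sum_any (\<lambda>d. smult (ann_const n) (creation_coeff r d * annih_coeff r (m + ?e \<alpha> - d) f)))"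
    by (rule Sum_any_sum, simp) (rule finite_subset[OF _ finite_vertex_coeff], auto)
  also have "\<dots> = (\<Sum>\<alpha>=1..r. smult (ann_const n) (vertex_coeff r (m + ?e \<alpha>) f))"
    unfolding vertex_coeff_def
    by (intro sum.cong refl Sum_any_hom[symmetric]) (simp_all add: sym.scale_right_distrib finite_vertex_coeff del: mult_eq_0_iff)
  finally show ?thesis
    by (simp only: sym.scale_sum_right)
qed

text \<open>The bound is uniform in \<open>m\<close> and \<open>i\<close>. It makes pairings with a
  kernel finite, since kernel exponents enter with the opposite sign.\<close>

lemma vertex_coeff_bounded_below:
  "\<exists>D::nat. \<forall>m i. vertex_coeff r m f \<noteq> 0 \<longrightarrow>
    Poly_Mapping.keys m \<subseteq> {1..r} \<and> - int D \<le> Poly_Mapping.lookup m i"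
proof -
  obtain D where D: "\<And>m i. annih_coeff r m f \<noteq> 0 \<Longrightarrow> - int D \<le> Poly_Mapping.lookup m i"
    using annih_coeff_bounded_below by blast
  have "Poly_Mapping.keys m \<subseteq> {1..r} \<and> - int D \<le> Poly_Mapping.lookup m i" if "vertex_coeff r m f \<noteq> 0" for m i
  proof -
    from that obtain d where "creation_coeff r d * annih_coeff r (m - d) f \<noteq> 0"
      unfolding vertex_coeff_def by (rule Sum_any.not_neutral_obtains_not_neutral)
    then have h: "creation_coeff r d \<noteq> 0" and e: "annih_coeff r (m - d) f \<noteq> 0" by auto
    have "Poly_Mapping.keys m \<subseteq> {1..r}"
      using keys_add[of d "m - d"] creation_coeff_support(1)[OF h] annih_coeff_support(1)[OF e] by auto
    with D[OF e, of i] creation_coeff_support(2)[OF h, of i] show ?thesis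
      by (simp add: lookup_minus)
  qed
  then show ?thesis
    by blast
qed

section \<open>Commuting the coefficients of two vertex operators\<close>

text \<open>Pushes exponents forward along the renumbering that \<open>zshift\<close> pulls back by
  \<open>map_key\<close>. It yields the \<open>a'\<close> of the overview.\<close>

definition shift_mon :: "nat \<Rightarrow> zmon \<Rightarrow> zmon" where
  "shift_mon s a = Poly_Mapping.Abs_poly_mapping (\<lambda>i. if s \<le> i then Poly_Mapping.lookup a (i - s) else 0)"

lemma lookup_shift_mon: "Poly_Mapping.lookup (shift_mon s a) i = (if s \<le> i then Poly_Mapping.lookup a (i - s) else 0)"
proof -
  have "{i. (if s \<le> i then Poly_Mapping.lookup a (i - s) else 0) \<noteq> 0} \<subseteq> (\<lambda>i. i + s) ` Poly_Mapping.keys a"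
  proof
    fix i assume "i \<in> {i. (if s \<le> i then Poly_Mapping.lookup a (i - s) else 0) \<noteq> 0}"
    then show "i \<in> (\<lambda>i. i + s) ` Poly_Mapping.keys a"
      by (intro image_eqI[of _ _ "i - s"]) (auto simp: in_keys_iff split: if_splits)
  qed
  then have "finite {i. (if s \<le> i then Poly_Mapping.lookup a (i - s) else 0) \<noteq> 0}"
    by (rule finite_subset) simp
  then show ?thesis
    unfolding shift_mon_def by (subst lookup_Abs_poly_mapping) auto
qed

lemma shift_mon_add: "shift_mon s (a + b) = shift_mon s a + shift_mon s b"
  by (rule poly_mapping_eqI) (simp add: lookup_shift_mon lookup_add)

lemma shift_mon_diff: "shift_mon s (a - b) = shift_mon s a - shift_mon s b"
  by (rule poly_mapping_eqI) (simp add: lookup_shift_mon lookup_minus)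

lemma shift_mon_single: "shift_mon s (Poly_Mapping.single i k) = Poly_Mapping.single (i + s) k"
  by (rule poly_mapping_eqI) (auto simp: lookup_shift_mon lookup_single when_def)

lemma shift_mon_0 [simp]: "shift_mon s 0 = 0"
  by (rule poly_mapping_eqI) (simp add: lookup_shift_mon)

lemma shift_mon_eq_0_iff [simp]: "shift_mon s a = 0 \<longleftrightarrow> a = 0"
proof
  assume "shift_mon s a = 0"
  then have "Poly_Mapping.lookup (shift_mon s a) (i + s) = 0" for i by simp
  then show "a = 0"
    by (intro poly_mapping_eqI) (simp add: lookup_shift_mon)
qed simp

lemma sum_split_shift:
  fixes g :: "nat \<Rightarrow> 'a::comm_monoid_add"
  shows "(\<Sum>\<alpha>=1..r+s. g \<alpha>) = (\<Sum>\<beta>=1..s. g \<beta>) + (\<Sum>\<alpha>=1..r. g (\<alpha> + s))"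
  using sum.ub_add_nat[of 1 s g r] sum.shift_bounds_cl_nat_ivl[of g 1 s r] by (simp add: add.commute)

lemma wt_split: "wt (r + s) m = wt s m + (\<Sum>\<alpha>=1..r. Poly_Mapping.lookup m (\<alpha> + s))"
  by (simp only: wt_def sum_split_shift)

text \<open>Position 0 is no variable, yet \<open>shift_mon s\<close> would move it onto
  \<open>z_s\<close>. Its vanishing keeps shifted monomials out of the first \<open>s\<close>
  variables.\<close>

lemma keys_0:
  fixes a :: zmon and r :: nat
  shows "Poly_Mapping.keys a \<subseteq> {1..r} \<Longrightarrow> Poly_Mapping.lookup a 0 = 0"
  by (subst not_in_keys_iff_lookup_eq_zero[symmetric]) (auto dest: subsetD)

lemma wt_shift_mon: "Poly_Mapping.keys a \<subseteq> {1..r} \<Longrightarrow> wt s (shift_mon s a) = 0"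
  by (auto simp: wt_def lookup_shift_mon keys_0 intro!: sum.neutral)

lemma wt_add_shift_mon: "Poly_Mapping.keys a \<subseteq> {1..r} \<Longrightarrow> wt (r + s) (shift_mon s a) = wt r a"
  unfolding wt_split by (simp add: wt_shift_mon) (simp add: wt_def lookup_shift_mon)

lemma keys_add_single:
  fixes a :: zmon
  shows "Poly_Mapping.keys a \<subseteq> A \<Longrightarrow> i \<in> A \<Longrightarrow> Poly_Mapping.keys (a + Poly_Mapping.single i k) \<subseteq> A"
  using keys_add[of a "Poly_Mapping.single i k"] by (auto split: if_splits)

lemma keys_diff_single:
  fixes a :: zmon
  shows "Poly_Mapping.keys a \<subseteq> A \<Longrightarrow> i \<in> A \<Longrightarrow> Poly_Mapping.keys (a - Poly_Mapping.single i k) \<subseteq> A"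
  using keys_add_single[of a A i "- k"] by (simp add: single_uminus)

lemma creation_coeff_low: "wt r m \<le> 0 \<Longrightarrow> creation_coeff r m = (if m = 0 then 1 else 0)"
  by (simp add: creation_coeff_eq cr.E_low)

text \<open>Removing \<open>z_\<beta>^n\<close> with \<open>\<beta> \<le> s\<close> leaves a
  negative exponent, where creation coefficients vanish. So the recurrence in \<open>r + s\<close>
  variables reduces to that in \<open>r\<close> variables.\<close>

lemma creation_coeff_shift_mon:
  assumes "Poly_Mapping.keys a \<subseteq> {1..r}"
  shows "creation_coeff (r + s) (shift_mon s a) = creation_coeff r a"
  using assms
proof (induction "nat (wt r a)" arbitrary: a rule: less_induct)
  case less
  note w = wt_add_shift_mon[OF less.prems, of s]
  show ?case
  proof (cases "wt r a \<le> 0")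
    case True
    then show ?thesis by (simp add: creation_coeff_low w)
  next
    case False
    define N where "N = nat (wt r a)"
    have N: "wt r a \<le> int N" by (simp add: N_def)
    let ?g = "\<lambda>n \<alpha>. smult (of_int (wt (r + s) (Poly_Mapping.single \<alpha> (int n))) * cre_const n)
      (psum n * creation_coeff (r + s) (shift_mon s a - Poly_Mapping.single \<alpha> (int n)))"
    have "smult (of_int (wt r a)) (creation_coeff (r + s) (shift_mon s a)) = (\<Sum>n=1..N. \<Sum>\<alpha>=1..r+s. ?g n \<alpha>)"
      using creation_coeff_euler[where u = "wt (r + s)" and m = "shift_mon s a", OF wt_add] N by (simp only: w)
    also have "\<dots> = (\<Sum>n=1..N. \<Sum>\<alpha>=1..r. smult (of_int (wt r (Poly_Mapping.single \<alpha> (int n))) * cre_const n)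
      (psum n * creation_coeff r (a - Poly_Mapping.single \<alpha> (int n))))"
    proof (rule sum.cong, rule refl)
      fix n assume n: "n \<in> {1..N}"
      have "?g n \<beta> = 0" if "\<beta> \<in> {1..s}" for \<beta>
      proof -
        have "Poly_Mapping.lookup (shift_mon s a - Poly_Mapping.single \<beta> (int n)) \<beta> < 0"
          using that n less.prems by (auto simp: lookup_minus lookup_shift_mon keys_0)
        then have "creation_coeff (r + s) (shift_mon s a - Poly_Mapping.single \<beta> (int n)) = 0"
          using creation_coeff_support(2) by (metis not_le)
        then show ?thesis by simp
      qed
      then have "(\<Sum>\<beta>=1..s. ?g n \<beta>) = 0"
        by (intro sum.neutral) blast
      moreover have "?g n (\<alpha> + s) = smult (of_int (wt r (Poly_Mapping.single \<alpha> (int n))) * cre_const n)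
          (psum n * creation_coeff r (a - Poly_Mapping.single \<alpha> (int n)))" if \<alpha>: "\<alpha> \<in> {1..r}" for \<alpha>
      proof -
        have "creation_coeff (r + s) (shift_mon s (a - Poly_Mapping.single \<alpha> (int n))) = creation_coeff r (a - Poly_Mapping.single \<alpha> (int n))"
          using \<alpha> n False by (intro less.hyps keys_diff_single less.prems) (auto simp: wt_diff wt_single)
        with \<alpha> show ?thesis
          by (simp add: shift_mon_diff shift_mon_single wt_single)
      qed
      ultimately show "(\<Sum>\<alpha>=1..r+s. ?g n \<alpha>) = (\<Sum>\<alpha>=1..r. smult (of_int (wt r (Poly_Mapping.single \<alpha> (int n))) * cre_const n)
          (psum n * creation_coeff r (a - Poly_Mapping.single \<alpha> (int n))))"
        by (simp only: sum_split_shift add_0_left cong: sum.cong)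
    qed
    also have "\<dots> = smult (of_int (wt r a)) (creation_coeff r a)"
      by (rule creation_coeff_euler[where u = "wt r", OF wt_add N, symmetric])
    finally show ?thesis
      using False by (auto dest: sym.scale_left_imp_eq[rotated])
  qed
qed

section \<open>The cross factor times the joint vertex operator\<close>

text \<open>The total degree is 0, so the nonpositive exponents beyond \<open>s\<close> add up to
  \<open>- wt s c\<close>, and none of them is smaller than their sum.\<close>

lemma cross_factor_bounded_below:
  assumes "cross_factor r s c \<noteq> 0"
  shows "- wt s c \<le> Poly_Mapping.lookup c i"
proof -
  note c = cross_factor_support[OF assms]
  have w: "0 \<le> wt s c"
    unfolding wt_def by (rule sum_nonneg) (use c(2) in auto)
  show ?thesis
  proof (cases "i \<in> {s<..r+s}")
    case True
    then have i: "i - s \<in> {1..r}" "i - s + s = i" by auto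
    have "- Poly_Mapping.lookup c (i - s + s) \<le> (\<Sum>\<alpha>=1..r. - Poly_Mapping.lookup c (\<alpha> + s))"
      by (rule member_le_sum) (use i c(3) in auto)
    also have "\<dots> = wt s c"
      using c(4) by (simp add: wt_split sum_negf)
    finally show ?thesis
      using i by simp
  next
    case False
    then have "i \<le> s \<or> i \<notin> Poly_Mapping.keys c"
      using c(1) by (auto simp: not_le)
    then have "0 \<le> Poly_Mapping.lookup c i"
      using c(2) by (auto simp: in_keys_iff)
    with w show ?thesis by simp
  qed
qed

text \<open>The vertex coefficient bounds each exponent of \<open>c\<close> from above. The bounds
  for the first \<open>s\<close> variables add up to the bound \<open>B\<close> on
  \<open>wt s c\<close>, and \<open>cross_factor_bounded_below\<close> turns it into a lower bound
  for every exponent.\<close>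

lemma finite_cross_vertex_coeff: "finite {c. smult (cross_factor r s c) (vertex_coeff (r + s) (m - c) f) \<noteq> 0}"
proof -
  obtain D :: nat where D: "\<And>m i. vertex_coeff (r + s) m f \<noteq> 0 \<Longrightarrow> - int D \<le> Poly_Mapping.lookup m i"
    using vertex_coeff_bounded_below[of "r + s" f] by blast
  define B where "B = (\<Sum>\<beta>=1..s. Poly_Mapping.lookup m \<beta> + int D)"
  show ?thesis
  proof (rule finite_subset)
    show "{c. smult (cross_factor r s c) (vertex_coeff (r + s) (m - c) f) \<noteq> 0} \<subseteq>
      {c. Poly_Mapping.keys c \<subseteq> {1..r+s} \<and>
        (\<forall>i\<in>{1..r+s}. - B \<le> Poly_Mapping.lookup c i \<and> Poly_Mapping.lookup c i \<le> Poly_Mapping.lookup m i + int D)}"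
    proof (rule subsetI, intro CollectI conjI ballI)
      fix c i assume "c \<in> {c. smult (cross_factor r s c) (vertex_coeff (r + s) (m - c) f) \<noteq> 0}"
      then have C: "cross_factor r s c \<noteq> 0" and vertex_coeff: "vertex_coeff (r + s) (m - c) f \<noteq> 0" by auto
      show "Poly_Mapping.keys c \<subseteq> {1..r+s}"
        by (rule cross_factor_support(1)[OF C])
      have u: "Poly_Mapping.lookup c i \<le> Poly_Mapping.lookup m i + int D" for i
        using D[OF vertex_coeff, of i] by (simp add: lookup_minus)
      then show "Poly_Mapping.lookup c i \<le> Poly_Mapping.lookup m i + int D" .
      have "wt s c \<le> B"
        unfolding wt_def B_def by (rule sum_mono) (rule u)
      with cross_factor_bounded_below[OF C, of i] show "- B \<le> Poly_Mapping.lookup c i" by simp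
    qed
  qed (rule finite_box, simp)
qed

definition cross_coeff :: "nat \<Rightarrow> nat \<Rightarrow> zmon \<Rightarrow> sym \<Rightarrow> sym" where
  "cross_coeff r s m f = Sum_any (\<lambda>c. smult (cross_factor r s c) (vertex_coeff (r + s) (m - c) f))"

lemma vertex_coeff_sum: "vertex_coeff r m (\<Sum>x\<in>X. g x) = (\<Sum>x\<in>X. vertex_coeff r m (g x))"
  by (induction X rule: infinite_finite_induct) (simp_all add: vertex_coeff_0 vertex_coeff_add)

lemma cross_coeff_add: "cross_coeff r s m (f + g) = cross_coeff r s m f + cross_coeff r s m g"
  unfolding cross_coeff_def vertex_coeff_add sym.scale_right_distrib by (rule Sum_any.distrib) (rule finite_cross_vertex_coeff)+

lemma cross_coeff_smult: "cross_coeff r s m (smult c f) = smult c (cross_coeff r s m f)"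
  unfolding cross_coeff_def
  by (subst Sum_any_hom[where h = "smult c", OF _ _ finite_cross_vertex_coeff])
    (simp_all add: sym.scale_right_distrib vertex_coeff_smult mult.commute)

text \<open>The cross factor is scalar and convolution commutes with shifts of \<open>m\<close>, so
  the relation is inherited from \<open>vertex_coeff (r + s)\<close>.\<close>

lemma cross_coeff_psum:
  assumes n: "n \<ge> 1"
  shows "cross_coeff r s m (psum n * f) = psum n * cross_coeff r s m f +
    smult (ann_const n) (\<Sum>\<alpha>=1..r+s. cross_coeff r s (m + Poly_Mapping.single \<alpha> (int n)) f)"
proof -
  let ?e = "\<lambda>\<alpha>. Poly_Mapping.single \<alpha> (int n)"
  let ?g = "\<lambda>m c. smult (cross_factor r s c) (vertex_coeff (r + s) (m - c) f)"
  have fin: "finite {c. smult (ann_const n) (?g m c) \<noteq> 0}" for m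
    by (rule finite_subset[OF _ finite_cross_vertex_coeff[of r s m f]]) auto
  have "smult (cross_factor r s c) (vertex_coeff (r + s) (m - c) (psum n * f)) =
      psum n * ?g m c + (\<Sum>\<alpha>=1..r+s. smult (ann_const n) (?g (m + ?e \<alpha>) c))" for c
  proof -
    have "m - c + ?e \<alpha> = m + ?e \<alpha> - c" for \<alpha>
      by simp
    then show ?thesis
      by (simp only: vertex_coeff_psum[OF n] sym.scale_right_distrib sym.scale_sum_right smult_mult_right
          sym.scale_left_commute)
  qed
  then have "cross_coeff r s m (psum n * f) =
      Sum_any (\<lambda>c. psum n * ?g m c + (\<Sum>\<alpha>=1..r+s. smult (ann_const n) (?g (m + ?e \<alpha>) c)))"
    by (simp only: cross_coeff_def)
  also have "\<dots> = Sum_any (\<lambda>c. psum n * ?g m c) +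
      Sum_any (\<lambda>c. \<Sum>\<alpha>=1..r+s. smult (ann_const n) (?g (m + ?e \<alpha>) c))"
  proof (rule Sum_any.distrib)
    show "finite {c. psum n * ?g m c \<noteq> 0}"
      by (rule finite_subset[OF _ finite_cross_vertex_coeff[of r s m f]]) auto
    show "finite {c. (\<Sum>\<alpha>=1..r+s. smult (ann_const n) (?g (m + ?e \<alpha>) c)) \<noteq> 0}"
    proof (rule finite_subset)
      show "finite (\<Union>\<alpha>\<in>{1..r+s}. {c. smult (ann_const n) (?g (m + ?e \<alpha>) c) \<noteq> 0})"
        by (intro finite_UN_I finite_atLeastAtMost fin)
    qed (auto elim!: sum.not_neutral_contains_not_neutral simp del: sym.scale_eq_0_iff)
  qed
  also have "Sum_any (\<lambda>c. psum n * ?g m c) = psum n * cross_coeff r s m f"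
    unfolding cross_coeff_def by (rule Sum_any_right_distrib[OF finite_cross_vertex_coeff, symmetric])
  also have "Sum_any (\<lambda>c. \<Sum>\<alpha>=1..r+s. smult (ann_const n) (?g (m + ?e \<alpha>) c)) =
      (\<Sum>\<alpha>=1..r+s. Sum_any (\<lambda>c. smult (ann_const n) (?g (m + ?e \<alpha>) c)))"
    by (rule Sum_any_sum, simp) (rule fin)
  also have "\<dots> = (\<Sum>\<alpha>=1..r+s. smult (ann_const n) (cross_coeff r s (m + ?e \<alpha>) f))"
    unfolding cross_coeff_def
    by (intro sum.cong refl Sum_any_hom[symmetric] finite_cross_vertex_coeff) (simp_all add: sym.scale_right_distrib)
  finally show ?thesis
    by (simp only: sym.scale_sum_right)
qed

lemma wt_creation_coeff_nonneg: "creation_coeff r m \<noteq> 0 \<Longrightarrow> wt s m \<ge> 0"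
  unfolding wt_def by (rule sum_nonneg) (rule creation_coeff_support(2))

text \<open>Initial values for the recurrence. The cross factor needs \<open>wt s c \<ge> 0\<close>,
  and the creation coefficient needs \<open>wt s c \<le> wt s b\<close>; with
  \<open>wt s b \<le> 0\<close> only \<open>c = 0\<close> remains.\<close>

lemma cross_coeff_one_low:
  assumes a: "Poly_Mapping.keys a \<subseteq> {1..r}" and b: "Poly_Mapping.keys b \<subseteq> {1..s}"
    and w: "wt s b \<le> 0"
  shows "cross_coeff r s (shift_mon s a + b) 1 = (if b = 0 then creation_coeff r a else 0)"
proof -
  let ?m = "shift_mon s a + b"
  have wm: "wt s ?m = wt s b"
    by (simp add: wt_add wt_shift_mon[OF a])
  have "smult (cross_factor r s c) (vertex_coeff (r + s) (?m - c) 1) = (if c = 0 then creation_coeff (r + s) ?m else 0)" for c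
  proof (cases "c = 0 \<or> creation_coeff (r + s) (?m - c) = 0")
    case False
    then have "wt s c \<le> 0"
      using wt_creation_coeff_nonneg[of "r + s" "?m - c" s] w by (simp add: wt_diff wm)
    with False show ?thesis
      by (simp add: cross_factor_low)
  qed (auto simp: vertex_coeff_one cross_factor_0)
  then have cross_coeff: "cross_coeff r s ?m 1 = creation_coeff (r + s) ?m"
    by (simp add: cross_coeff_def)
  show ?thesis
  proof (cases "b = 0")
    case True
    with cross_coeff a show ?thesis
      by (simp add: creation_coeff_shift_mon)
  next
    case False
    have "creation_coeff (r + s) ?m = 0"
    proof (rule ccontr)
      assume "creation_coeff (r + s) ?m \<noteq> 0"
      note nonneg = creation_coeff_support(2)[OF this]
      \<comment> \<open>In the first \<open>s\<close> variables the joint exponents are those of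
        \<open>b\<close>. Being nonnegative with sum at most 0, they all vanish, against
        \<open>b \<noteq> 0\<close>.\<close>
      have b': "Poly_Mapping.lookup b i \<ge> 0" if "i \<in> {1..s}" for i
      proof -
        have "Poly_Mapping.lookup (shift_mon s a) i = 0"
          using that a by (auto simp: lookup_shift_mon keys_0)
        with nonneg[of i] show ?thesis
          by (simp add: lookup_add)
      qed
      have "wt s b = 0"
        using w b' by (intro antisym) (auto simp: wt_def intro: sum_nonneg)
      with b' have "\<forall>i\<in>{1..s}. Poly_Mapping.lookup b i = 0"
        unfolding wt_def by (subst (asm) sum_nonneg_eq_0_iff) auto
      then have "Poly_Mapping.keys b = {}"
        using b by (intro equals0I) (auto simp: in_keys_iff dest: subsetD)
      with False show False by simp
    qed
    with cross_coeff False show ?thesis by simp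
  qed
qed

text \<open>Product rule for the Euler derivation in \<open>z_1, ..., z_s\<close>: differentiating
  the cross factor gives the terms with \<open>cross_mon\<close>, differentiating the creation
  series those with a bare \<open>psum n\<close>.\<close>

lemma cross_coeff_one_euler:
  assumes a: "Poly_Mapping.keys a \<subseteq> {1..r}" and N: "wt s m \<le> int N" "wt (r + s) m \<le> int N"
  shows "smult (of_int (wt s m)) (cross_coeff r s m 1) =
    (\<Sum>n=1..N. \<Sum>\<beta>=1..s. smult (of_nat n * cre_const n) (psum n * cross_coeff r s (m - Poly_Mapping.single \<beta> (int n)) 1 +
      smult (ann_const n) (\<Sum>\<alpha>=1..r. cross_coeff r s (m - cross_mon (n, \<alpha> + s, \<beta>)) 1)))"
proof -
  let ?C = "cross_factor r s" and ?h = "creation_coeff (r + s)"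
  let ?I = "{1..N} \<times> {s+1..r+s} \<times> {1..s}" and ?J = "{1..N} \<times> {1..s}"
  let ?e = "\<lambda>(n, \<beta>). Poly_Mapping.single \<beta> (int n)"
  let ?A = "\<lambda>i c. smult (of_nat (fst i) * cre_const (fst i) * ann_const (fst i)) (smult (?C (c - cross_mon i)) (?h (m - c)))"
  let ?B = "\<lambda>j c. smult (of_nat (fst j) * cre_const (fst j)) (psum (fst j) * smult (?C c) (?h (m - ?e j - c)))"
  have cross_coeff: "cross_coeff r s m 1 = Sum_any (\<lambda>c. smult (?C c) (?h (m - c)))" for m
    by (simp add: cross_coeff_def vertex_coeff_one)
  have fin: "finite {c. smult (?C c) (?h (m - c)) \<noteq> 0}" for m
    using finite_cross_vertex_coeff[of r s m 1] by (simp only: vertex_coeff_one)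
  \<comment> \<open>Derivative of the cross factor. Where \<open>?h (m - c)\<close> is nonzero,
    \<open>m - c\<close> has nonnegative degree, so \<open>N\<close> also bounds
    \<open>wt s c\<close>.\<close>
  have 1: "smult (of_int (wt s c) * ?C c) (?h (m - c)) = (\<Sum>i\<in>?I. ?A i c)" for c
  proof (cases "?h (m - c) = 0")
    case False
    then have "wt s c \<le> int N"
      using wt_creation_coeff_nonneg[OF False, of s] N(1) by (simp add: wt_diff)
    then show ?thesis
      by (simp only: cross_factor_euler sum.cartesian_product sym.scale_sum_left sym.scale_scale case_prod_beta
          prod.collapse fst_conv snd_conv)
  qed simp
  \<comment> \<open>Derivative of the creation series. The cross factor has total degree 0, so
    \<open>m - c\<close> has the total degree of \<open>m\<close>; terms in variables beyond
    \<open>s\<close> drop because \<open>wt s\<close> vanishes on them.\<close>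
  have 2: "smult (of_int (wt s (m - c))) (smult (?C c) (?h (m - c))) = (\<Sum>j\<in>?J. ?B j c)" for c
  proof (cases "?C c = 0")
    case False
    then have "wt (r + s) (m - c) \<le> int N"
      using cross_factor_support(4)[OF False] N(2) by (simp add: wt_diff)
    from creation_coeff_euler[where u = "wt s", OF wt_add this]
    have "smult (of_int (wt s (m - c))) (?h (m - c)) = (\<Sum>n=1..N. \<Sum>\<beta>=1..s.
        smult (of_int (wt s (Poly_Mapping.single \<beta> (int n))) * cre_const n) (psum n * ?h (m - c - Poly_Mapping.single \<beta> (int n))))"
      unfolding sum_split_shift by (simp add: wt_single)
    also have "\<dots> = (\<Sum>j\<in>?J. smult (of_nat (fst j) * cre_const (fst j)) (psum (fst j) * ?h (m - ?e j - c)))"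
      unfolding sum.cartesian_product
      by (rule sum.cong) (auto simp: wt_single diff_diff_eq add.commute)
    finally have "smult (?C c) (smult (of_int (wt s (m - c))) (?h (m - c))) =
        smult (?C c) (\<Sum>j\<in>?J. smult (of_nat (fst j) * cre_const (fst j)) (psum (fst j) * ?h (m - ?e j - c)))"
      by (rule arg_cong)
    then show ?thesis
      by (simp only: sym.scale_left_commute sym.scale_sum_right smult_mult_right)
  qed simp
  have 3: "smult (of_int (wt s m)) (smult (?C c) (?h (m - c))) = (\<Sum>i\<in>?I. ?A i c) + (\<Sum>j\<in>?J. ?B j c)" for c
  proof -
    have "wt s m = wt s c + wt s (m - c)"
      by (simp add: wt_diff)
    then show ?thesis
      unfolding 1[symmetric] 2[symmetric] by (simp only: of_int_add sym.scale_left_distrib sym.scale_scale distrib_right)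
  qed
  have shift: "Sum_any (\<lambda>c. smult (?C (c - x)) (?h (m - c))) = cross_coeff r s (m - x) 1" for x
    unfolding cross_coeff using Sum_any_shift[of "\<lambda>c. smult (?C c) (?h (m - x - c))" "- x"]
    by (simp add: algebra_simps)
  have fin': "finite {c. smult (?C (c - x)) (?h (m - c)) \<noteq> 0}" for x
  proof (rule finite_subset)
    show "{c. smult (?C (c - x)) (?h (m - c)) \<noteq> 0} \<subseteq> (\<lambda>c. c + x) ` {c. smult (?C c) (?h (m - x - c)) \<noteq> 0}"
    proof
      fix c assume "c \<in> {c. smult (?C (c - x)) (?h (m - c)) \<noteq> 0}"
      then show "c \<in> (\<lambda>c. c + x) ` {c. smult (?C c) (?h (m - x - c)) \<noteq> 0}"
        by (intro image_eqI[of _ _ "c - x"]) auto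
    qed
  qed (intro finite_imageI fin)
  have finA: "finite {c. ?A i c \<noteq> 0}" for i
    by (rule finite_subset[OF _ fin'[of "cross_mon i"]]) auto
  have finB: "finite {c. ?B j c \<noteq> 0}" for j
    by (rule finite_subset[OF _ fin[of "m - ?e j"]]) auto
  have "smult (of_int (wt s m)) (cross_coeff r s m 1) = Sum_any (\<lambda>c. (\<Sum>i\<in>?I. ?A i c) + (\<Sum>j\<in>?J. ?B j c))"
    unfolding cross_coeff by (subst Sum_any_hom[OF _ _ fin]) (simp_all only: sym.scale_right_distrib sym.scale_zero_right 3)
  also have "\<dots> = Sum_any (\<lambda>c. \<Sum>i\<in>?I. ?A i c) + Sum_any (\<lambda>c. \<Sum>j\<in>?J. ?B j c)"
  proof (rule Sum_any.distrib)
    show "finite {c. (\<Sum>i\<in>?I. ?A i c) \<noteq> 0}"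
      by (rule finite_subset[of _ "\<Union>i\<in>?I. {c. ?A i c \<noteq> 0}"])
        (blast elim: sum.not_neutral_contains_not_neutral, intro finite_UN_I finite_cartesian_product finite_atLeastAtMost finA)
    show "finite {c. (\<Sum>j\<in>?J. ?B j c) \<noteq> 0}"
      by (rule finite_subset[of _ "\<Union>j\<in>?J. {c. ?B j c \<noteq> 0}"])
        (blast elim: sum.not_neutral_contains_not_neutral, intro finite_UN_I finite_cartesian_product finite_atLeastAtMost finB)
  qed
  also have "Sum_any (\<lambda>c. \<Sum>i\<in>?I. ?A i c) = (\<Sum>i\<in>?I. Sum_any (?A i))"
    by (rule Sum_any_sum) (intro finite_cartesian_product finite_atLeastAtMost, rule finA)
  also have "\<dots> = (\<Sum>i\<in>?I. smult (of_nat (fst i) * cre_const (fst i) * ann_const (fst i)) (cross_coeff r s (m - cross_mon i) 1))"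
    unfolding shift[symmetric]
    by (intro sum.cong refl Sum_any_hom[symmetric] fin') (simp_all add: sym.scale_right_distrib)
  also have "\<dots> = (\<Sum>n=1..N. \<Sum>\<alpha>=s+1..r+s. \<Sum>\<beta>=1..s.
      smult (of_nat n * cre_const n * ann_const n) (cross_coeff r s (m - cross_mon (n, \<alpha>, \<beta>)) 1))"
    unfolding sum.cartesian_product by (simp add: case_prod_beta)
  also have "\<dots> = (\<Sum>n=1..N. \<Sum>\<beta>=1..s. \<Sum>\<alpha>=1..r.
      smult (of_nat n * cre_const n * ann_const n) (cross_coeff r s (m - cross_mon (n, \<alpha> + s, \<beta>)) 1))"
  proof (rule sum.cong, rule refl)
    fix n
    show "(\<Sum>\<alpha>=s+1..r+s. \<Sum>\<beta>=1..s. smult (of_nat n * cre_const n * ann_const n) (cross_coeff r s (m - cross_mon (n, \<alpha>, \<beta>)) 1)) =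
      (\<Sum>\<beta>=1..s. \<Sum>\<alpha>=1..r. smult (of_nat n * cre_const n * ann_const n) (cross_coeff r s (m - cross_mon (n, \<alpha> + s, \<beta>)) 1))"
      using sum.shift_bounds_cl_nat_ivl[of "\<lambda>\<alpha>. \<Sum>\<beta>=1..s. smult (of_nat n * cre_const n * ann_const n) (cross_coeff r s (m - cross_mon (n, \<alpha>, \<beta>)) 1)" 1 s r]
      by (subst sum.swap) (simp add: add.commute)
  qed
  also have "Sum_any (\<lambda>c. \<Sum>j\<in>?J. ?B j c) = (\<Sum>j\<in>?J. Sum_any (?B j))"
    by (rule Sum_any_sum) (intro finite_cartesian_product finite_atLeastAtMost, rule finB)
  also have "\<dots> = (\<Sum>j\<in>?J. smult (of_nat (fst j) * cre_const (fst j)) (psum (fst j) * cross_coeff r s (m - ?e j) 1))"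
    unfolding cross_coeff
    by (intro sum.cong refl Sum_any_hom[symmetric, where h = "\<lambda>x. smult (of_nat (fst _) * cre_const (fst _)) (psum (fst _) * x)"] fin)
      (simp_all add: sym.scale_right_distrib distrib_left)
  also have "\<dots> = (\<Sum>n=1..N. \<Sum>\<beta>=1..s. smult (of_nat n * cre_const n) (psum n * cross_coeff r s (m - Poly_Mapping.single \<beta> (int n)) 1))"
    unfolding sum.cartesian_product by (simp add: case_prod_beta)
  finally show ?thesis
    by (simp only: sum.distrib sym.scale_right_distrib sym.scale_sum_right sym.scale_scale add.commute)
qed

text \<open>The left side inherits the recurrence of \<open>creation_coeff s b\<close>. Moving
  \<open>p_n\<close> through \<open>vertex_coeff r a\<close> replaces \<open>a\<close> by
  \<open>a + n e_\<alpha>\<close> in the commutator, so the induction must leave \<open>a\<close>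
  arbitrary.\<close>

lemma vertex_coeff_creation_coeff:
  assumes "Poly_Mapping.keys a \<subseteq> {1..r}" "Poly_Mapping.keys b \<subseteq> {1..s}"
  shows "vertex_coeff r a (creation_coeff s b) = cross_coeff r s (shift_mon s a + b) 1"
  using assms
proof (induction "nat (wt s b)" arbitrary: a b rule: less_induct)
  case less
  note a = less.prems(1) and b = less.prems(2)
  let ?e = "\<lambda>\<alpha> n. Poly_Mapping.single \<alpha> (int n)"
  show ?case
  proof (cases "wt s b \<le> 0")
    case True
    with a b show ?thesis
      by (simp add: cross_coeff_one_low creation_coeff_low vertex_coeff_one vertex_coeff_0)
  next
    case False
    let ?m = "shift_mon s a + b"
    define N where "N = max (nat (wt s b)) (nat (wt (r + s) ?m))"
    have wm: "wt s ?m = wt s b"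
      by (simp add: wt_add wt_shift_mon[OF a])
    have N: "wt s b \<le> int N" "wt s ?m \<le> int N" "wt (r + s) ?m \<le> int N"
      by (auto simp: N_def wm)
    have IH: "vertex_coeff r a' (creation_coeff s (b - ?e \<beta> n)) = cross_coeff r s (shift_mon s a' + (b - ?e \<beta> n)) 1"
      if "Poly_Mapping.keys a' \<subseteq> {1..r}" "\<beta> \<in> {1..s}" "n \<in> {1..N}" for a' \<beta> n
      using that False b by (intro less.hyps keys_diff_single) (auto simp: wt_diff wt_single)
    have "smult (of_int (wt s b)) (vertex_coeff r a (creation_coeff s b)) = vertex_coeff r a (smult (of_int (wt s b)) (creation_coeff s b))"
      by (simp only: vertex_coeff_smult)
    also have "\<dots> = (\<Sum>n=1..N. \<Sum>\<beta>=1..s. smult (of_int (wt s (?e \<beta> n)) * cre_const n) (vertex_coeff r a (psum n * creation_coeff s (b - ?e \<beta> n))))"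
      by (simp only: creation_coeff_euler[where u = "wt s", OF wt_add N(1)] vertex_coeff_sum vertex_coeff_smult)
    also have "\<dots> = (\<Sum>n=1..N. \<Sum>\<beta>=1..s. smult (of_nat n * cre_const n) (psum n * cross_coeff r s (?m - ?e \<beta> n) 1 +
      smult (ann_const n) (\<Sum>\<alpha>=1..r. cross_coeff r s (?m - cross_mon (n, \<alpha> + s, \<beta>)) 1)))"
    proof (intro sum.cong refl)
      fix n \<beta> assume n: "n \<in> {1..N}" and \<beta>: "\<beta> \<in> {1..s}"
      have 1: "vertex_coeff r a (creation_coeff s (b - ?e \<beta> n)) = cross_coeff r s (?m - ?e \<beta> n) 1"
        using IH[OF a \<beta> n] by (simp add: add_diff_eq)
      have 2: "vertex_coeff r (a + ?e \<alpha> n) (creation_coeff s (b - ?e \<beta> n)) = cross_coeff r s (?m - cross_mon (n, \<alpha> + s, \<beta>)) 1"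
        if "\<alpha> \<in> {1..r}" for \<alpha>
      proof -
        \<comment> \<open>Passing \<open>n\<close> from the exponent of \<open>z_\<beta>\<close> to
          that of \<open>z_(\<alpha>+s)\<close> is division by a cross monomial.\<close>
        have "shift_mon s (a + ?e \<alpha> n) + (b - ?e \<beta> n) = ?m - cross_mon (n, \<alpha> + s, \<beta>)"
          by (simp add: shift_mon_add shift_mon_single cross_mon_def algebra_simps)
        with IH[OF keys_add_single[OF a that, of "int n"] \<beta> n] show ?thesis by simp
      qed
      have "of_int (wt s (?e \<beta> n)) = (of_nat n :: qt)"
        using \<beta> by (simp add: wt_single)
      with n show "smult (of_int (wt s (?e \<beta> n)) * cre_const n) (vertex_coeff r a (psum n * creation_coeff s (b - ?e \<beta> n))) =
        smult (of_nat n * cre_const n) (psum n * cross_coeff r s (?m - ?e \<beta> n) 1 +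
        smult (ann_const n) (\<Sum>\<alpha>=1..r. cross_coeff r s (?m - cross_mon (n, \<alpha> + s, \<beta>)) 1))"
        by (simp add: vertex_coeff_psum 1 2)
    qed
    also have "\<dots> = smult (of_int (wt s b)) (cross_coeff r s ?m 1)"
      unfolding cross_coeff_one_euler[OF a N(2,3), symmetric] wm ..
    finally show ?thesis
      using False by (auto dest: sym.scale_left_imp_eq[rotated])
  qed
qed

text \<open>Moving \<open>p_n\<close> through both operators shifts first \<open>b\<close>, then
  \<open>a\<close>; together these shifts are the \<open>r + s\<close> shifts in
  \<open>cross_coeff_psum\<close>.\<close>

lemma vertex_coeff_vertex_coeff:
  assumes "Poly_Mapping.keys a \<subseteq> {1..r}" "Poly_Mapping.keys b \<subseteq> {1..s}"
  shows "vertex_coeff r a (vertex_coeff s b f) = cross_coeff r s (shift_mon s a + b) f"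
  using assms
proof (induction f arbitrary: a b rule: sym_induct)
  case one
  then show ?case
    by (simp add: vertex_coeff_one vertex_coeff_creation_coeff)
next
  case (psum n f)
  note a = psum.prems(1) and b = psum.prems(2) and n = psum.hyps(1)
  let ?e = "\<lambda>\<alpha>. Poly_Mapping.single \<alpha> (int n)"
  let ?m = "shift_mon s a + b"
  have 1: "vertex_coeff r (a + ?e \<alpha>) (vertex_coeff s b f) = cross_coeff r s (?m + ?e (\<alpha> + s)) f" if "\<alpha> \<in> {1..r}" for \<alpha>
  proof -
    have "shift_mon s (a + ?e \<alpha>) + b = ?m + ?e (\<alpha> + s)"
      by (simp add: shift_mon_add shift_mon_single ac_simps)
    with psum.IH[OF keys_add_single[OF a that, of "int n"] b] show ?thesis by simp
  qed
  have 2: "vertex_coeff r a (vertex_coeff s (b + ?e \<beta>) f) = cross_coeff r s (?m + ?e \<beta>) f" if "\<beta> \<in> {1..s}" for \<beta>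
    using psum.IH[OF a keys_add_single[OF b that, of "int n"]] by (simp add: add.assoc)
  have "vertex_coeff r a (vertex_coeff s b (psum n * f)) = psum n * vertex_coeff r a (vertex_coeff s b f) +
      smult (ann_const n) (\<Sum>\<alpha>=1..r. vertex_coeff r (a + ?e \<alpha>) (vertex_coeff s b f)) +
      smult (ann_const n) (\<Sum>\<beta>=1..s. vertex_coeff r a (vertex_coeff s (b + ?e \<beta>) f))"
    by (simp only: vertex_coeff_psum[OF n] vertex_coeff_add vertex_coeff_smult vertex_coeff_sum)
  also have "\<dots> = psum n * cross_coeff r s ?m f + smult (ann_const n) (\<Sum>\<alpha>=1..r. cross_coeff r s (?m + ?e (\<alpha> + s)) f) +
      smult (ann_const n) (\<Sum>\<beta>=1..s. cross_coeff r s (?m + ?e \<beta>) f)"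
    by (simp add: 1 2 psum.IH[OF a b])
  also have "\<dots> = cross_coeff r s ?m (psum n * f)"
    by (simp only: cross_coeff_psum[OF n] sum_split_shift sym.scale_right_distrib add_ac)
  finally show ?case .
qed (simp_all add: vertex_coeff_add vertex_coeff_smult cross_coeff_add cross_coeff_smult)

section \<open>Supports of iterated Laurent series\<close>

text \<open>The condition of \<open>iterated_laurent\<close> as a property of supports, so that it
  passes to subsets and sums of sets.\<close>

definition laurent_supp :: "nat \<Rightarrow> zmon set \<Rightarrow> bool" where
  "laurent_supp n S \<longleftrightarrow> (\<forall>m\<in>S. Poly_Mapping.keys m \<subseteq> {1..n}) \<and>
     (\<forall>\<alpha>\<in>{1..n}. \<forall>e :: nat \<Rightarrow> int. \<exists>b. \<forall>m\<in>S.
        (\<forall>\<beta>\<in>{1..<\<alpha>}. Poly_Mapping.lookup m \<beta> = e \<beta>) \<longrightarrow> b \<le> Poly_Mapping.lookup m \<alpha>)"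

lemma iterated_laurent_laurent_supp: "iterated_laurent n K \<longleftrightarrow> laurent_supp n {m. K m \<noteq> 0}"
  unfolding iterated_laurent_def laurent_supp_def by blast

lemma laurent_supp_keys: "laurent_supp n S \<Longrightarrow> m \<in> S \<Longrightarrow> Poly_Mapping.keys m \<subseteq> {1..n}"
  by (simp add: laurent_supp_def)

lemma laurent_supp_subset: "laurent_supp n T \<Longrightarrow> S \<subseteq> T \<Longrightarrow> laurent_supp n S"
  unfolding laurent_supp_def by (meson subsetD)

text \<open>A box contains only finitely many choices of the earlier exponents, and the least of
  their bounds serves all.\<close>

lemma laurent_supp_box:
  assumes "laurent_supp n S" "\<alpha> \<in> {1..n}"
  shows "\<exists>b. \<forall>m\<in>S. (\<forall>\<beta>\<in>{1..<\<alpha>}. \<bar>Poly_Mapping.lookup m \<beta>\<bar> \<le> B) \<longrightarrow> b \<le> Poly_Mapping.lookup m \<alpha>"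
proof -
  from assms obtain b where b: "\<And>e m. m \<in> S \<Longrightarrow> (\<forall>\<beta>\<in>{1..<\<alpha>}. Poly_Mapping.lookup m \<beta> = e \<beta>) \<Longrightarrow>
      b e \<le> Poly_Mapping.lookup m \<alpha>"
    unfolding laurent_supp_def by metis
  let ?P = "PiE {1..<\<alpha>} (\<lambda>_. {- B..B})"
  have fin: "finite (b ` ?P)"
    by (intro finite_imageI finite_PiE) auto
  show ?thesis
  proof (intro exI[of _ "Min (b ` ?P)"] ballI impI)
    fix m assume m: "m \<in> S" and B: "\<forall>\<beta>\<in>{1..<\<alpha>}. \<bar>Poly_Mapping.lookup m \<beta>\<bar> \<le> B"
    \<comment> \<open>Restriction puts the exponents into the finite set \<open>?P\<close>; the
      support condition only looks at positions below \<open>\<alpha>\<close>.\<close>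
    let ?e = "restrict (Poly_Mapping.lookup m) {1..<\<alpha>}"
    have "?e \<in> ?P"
      using B by (auto simp: abs_le_iff)
    then have "Min (b ` ?P) \<le> b ?e"
      using fin by (intro Min_le) auto
    also have "b ?e \<le> Poly_Mapping.lookup m \<alpha>"
      by (rule b[OF m]) simp
    finally show "Min (b ` ?P) \<le> Poly_Mapping.lookup m \<alpha>" .
  qed
qed

text \<open>Induction over the variables: once the earlier exponents lie in a box, the next ones of
  \<open>x\<close> and \<open>y\<close> are bounded below, and an upper bound on their sum bounds
  each from above.\<close>

lemma laurent_supp_pair_bound:
  assumes S: "laurent_supp n S" and T: "laurent_supp n T" and "k \<le> n"
  shows "\<exists>B. \<forall>x\<in>S. \<forall>y\<in>T. (\<forall>\<beta>\<in>{1..k}. Poly_Mapping.lookup x \<beta> + Poly_Mapping.lookup y \<beta> \<le> D \<beta>) \<longrightarrow>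
    (\<forall>\<beta>\<in>{1..k}. \<bar>Poly_Mapping.lookup x \<beta>\<bar> \<le> B \<and> \<bar>Poly_Mapping.lookup y \<beta>\<bar> \<le> B)"
  using \<open>k \<le> n\<close>
proof (induction k)
  case (Suc k)
  then obtain B where B: "\<And>x y \<beta>. x \<in> S \<Longrightarrow> y \<in> T \<Longrightarrow>
      (\<forall>\<beta>\<in>{1..k}. Poly_Mapping.lookup x \<beta> + Poly_Mapping.lookup y \<beta> \<le> D \<beta>) \<Longrightarrow>
      \<beta> \<in> {1..k} \<Longrightarrow> \<bar>Poly_Mapping.lookup x \<beta>\<bar> \<le> B \<and> \<bar>Poly_Mapping.lookup y \<beta>\<bar> \<le> B"
    by (metis Suc_leD)
  have \<alpha>: "Suc k \<in> {1..n}" using Suc.prems by simp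
  obtain b1 where b1: "\<And>m. m \<in> S \<Longrightarrow> (\<forall>\<beta>\<in>{1..k}. \<bar>Poly_Mapping.lookup m \<beta>\<bar> \<le> B) \<Longrightarrow> b1 \<le> Poly_Mapping.lookup m (Suc k)"
    using laurent_supp_box[OF S \<alpha>, of B] by (auto simp: atLeastLessThanSuc_atLeastAtMost)
  obtain b2 where b2: "\<And>m. m \<in> T \<Longrightarrow> (\<forall>\<beta>\<in>{1..k}. \<bar>Poly_Mapping.lookup m \<beta>\<bar> \<le> B) \<Longrightarrow> b2 \<le> Poly_Mapping.lookup m (Suc k)"
    using laurent_supp_box[OF T \<alpha>, of B] by (auto simp: atLeastLessThanSuc_atLeastAtMost)
  define B' where "B' = max B (\<bar>b1\<bar> + \<bar>b2\<bar> + \<bar>D (Suc k)\<bar>)"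
  show ?case
  proof (intro exI[of _ B'] ballI impI)
    fix x y \<beta>
    assume x: "x \<in> S" and y: "y \<in> T" and \<beta>: "\<beta> \<in> {1..Suc k}"
      and le: "\<forall>\<beta>\<in>{1..Suc k}. Poly_Mapping.lookup x \<beta> + Poly_Mapping.lookup y \<beta> \<le> D \<beta>"
    from le have le': "\<forall>\<beta>\<in>{1..k}. Poly_Mapping.lookup x \<beta> + Poly_Mapping.lookup y \<beta> \<le> D \<beta>"
      by simp
    note B' = B[OF x y le']
    show "\<bar>Poly_Mapping.lookup x \<beta>\<bar> \<le> B' \<and> \<bar>Poly_Mapping.lookup y \<beta>\<bar> \<le> B'"
    proof (cases "\<beta> = Suc k")
      case True
      have "b1 \<le> Poly_Mapping.lookup x (Suc k)" "b2 \<le> Poly_Mapping.lookup y (Suc k)"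
        using b1[OF x] b2[OF y] B' by blast+
      moreover have "Poly_Mapping.lookup x (Suc k) + Poly_Mapping.lookup y (Suc k) \<le> D (Suc k)"
        using le by simp
      ultimately show ?thesis
        unfolding True B'_def by linarith
    next
      case False
      with \<beta> have "\<beta> \<in> {1..k}" by auto
      from B'[OF this] show ?thesis
        unfolding B'_def by linarith
    qed
  qed
qed simp

lemma finite_laurent_supp_pairs:
  assumes S: "laurent_supp n S" and T: "laurent_supp n T"
  shows "finite {(x, y). x \<in> S \<and> y \<in> T \<and>
    (\<forall>\<beta>\<in>{1..n}. Poly_Mapping.lookup x \<beta> + Poly_Mapping.lookup y \<beta> \<le> D \<beta>)}"
proof -
  obtain B where B: "\<And>x y \<beta>. x \<in> S \<Longrightarrow> y \<in> T \<Longrightarrow>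
      (\<forall>\<beta>\<in>{1..n}. Poly_Mapping.lookup x \<beta> + Poly_Mapping.lookup y \<beta> \<le> D \<beta>) \<Longrightarrow>
      \<beta> \<in> {1..n} \<Longrightarrow> \<bar>Poly_Mapping.lookup x \<beta>\<bar> \<le> B \<and> \<bar>Poly_Mapping.lookup y \<beta>\<bar> \<le> B"
    using laurent_supp_pair_bound[OF S T order_refl, of D] by metis
  let ?X = "{m :: zmon. Poly_Mapping.keys m \<subseteq> {1..n} \<and>
    (\<forall>i\<in>{1..n}. - B \<le> Poly_Mapping.lookup m i \<and> Poly_Mapping.lookup m i \<le> B)}"
  have "{(x, y). x \<in> S \<and> y \<in> T \<and>
    (\<forall>\<beta>\<in>{1..n}. Poly_Mapping.lookup x \<beta> + Poly_Mapping.lookup y \<beta> \<le> D \<beta>)} \<subseteq> ?X \<times> ?X"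
  proof
    fix p
    assume "p \<in> {(x, y). x \<in> S \<and> y \<in> T \<and>
      (\<forall>\<beta>\<in>{1..n}. Poly_Mapping.lookup x \<beta> + Poly_Mapping.lookup y \<beta> \<le> D \<beta>)}"
    then obtain x y where p: "p = (x, y)" and x: "x \<in> S" and y: "y \<in> T"
      and le: "\<forall>\<beta>\<in>{1..n}. Poly_Mapping.lookup x \<beta> + Poly_Mapping.lookup y \<beta> \<le> D \<beta>"
      by blast
    from B[OF x y le] laurent_supp_keys[OF S x] laurent_supp_keys[OF T y] show "p \<in> ?X \<times> ?X"
      unfolding p by (simp add: abs_le_iff minus_le_iff)
  qed
  then show ?thesis
    by (rule finite_subset) (intro finite_cartesian_product finite_box finite_atLeastAtMost)
qed

text \<open>Fixing the earlier exponents of \<open>x + y\<close> confines those of \<open>x\<close>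
  and \<open>y\<close> to a box, where \<open>laurent_supp_box\<close> bounds the next exponent of
  each.\<close>

lemma laurent_supp_sum:
  assumes S: "laurent_supp n S" and T: "laurent_supp n T"
  shows "laurent_supp n {x + y | x y. x \<in> S \<and> y \<in> T}"
  unfolding laurent_supp_def
proof (intro conjI ballI allI)
  fix m assume "m \<in> {x + y | x y. x \<in> S \<and> y \<in> T}"
  then obtain x y where "m = x + y" "x \<in> S" "y \<in> T" by blast
  with laurent_supp_keys[OF S, of x] laurent_supp_keys[OF T, of y] keys_add[of x y]
  show "Poly_Mapping.keys m \<subseteq> {1..n}" by blast
next
  fix \<alpha> :: nat and e :: "nat \<Rightarrow> int"
  assume \<alpha>: "\<alpha> \<in> {1..n}"
  then have k: "\<alpha> - 1 \<le> n" and set: "{1..\<alpha> - 1} = {1..<\<alpha>}" by auto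
  obtain B where B: "\<And>x y \<beta>. x \<in> S \<Longrightarrow> y \<in> T \<Longrightarrow>
      (\<forall>\<beta>\<in>{1..<\<alpha>}. Poly_Mapping.lookup x \<beta> + Poly_Mapping.lookup y \<beta> \<le> e \<beta>) \<Longrightarrow>
      \<beta> \<in> {1..<\<alpha>} \<Longrightarrow> \<bar>Poly_Mapping.lookup x \<beta>\<bar> \<le> B \<and> \<bar>Poly_Mapping.lookup y \<beta>\<bar> \<le> B"
    using laurent_supp_pair_bound[OF S T k, of e] unfolding set by metis
  obtain b1 where b1: "\<And>m. m \<in> S \<Longrightarrow> (\<forall>\<beta>\<in>{1..<\<alpha>}. \<bar>Poly_Mapping.lookup m \<beta>\<bar> \<le> B) \<Longrightarrow> b1 \<le> Poly_Mapping.lookup m \<alpha>"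
    using laurent_supp_box[OF S \<alpha>, of B] by blast
  obtain b2 where b2: "\<And>m. m \<in> T \<Longrightarrow> (\<forall>\<beta>\<in>{1..<\<alpha>}. \<bar>Poly_Mapping.lookup m \<beta>\<bar> \<le> B) \<Longrightarrow> b2 \<le> Poly_Mapping.lookup m \<alpha>"
    using laurent_supp_box[OF T \<alpha>, of B] by blast
  show "\<exists>b. \<forall>m\<in>{x + y | x y. x \<in> S \<and> y \<in> T}.
      (\<forall>\<beta>\<in>{1..<\<alpha>}. Poly_Mapping.lookup m \<beta> = e \<beta>) \<longrightarrow> b \<le> Poly_Mapping.lookup m \<alpha>"
  proof (intro exI[of _ "b1 + b2"] ballI impI)
    fix m assume "m \<in> {x + y | x y. x \<in> S \<and> y \<in> T}" and e: "\<forall>\<beta>\<in>{1..<\<alpha>}. Poly_Mapping.lookup m \<beta> = e \<beta>"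
    then obtain x y where m: "m = x + y" and x: "x \<in> S" and y: "y \<in> T" by blast
    have "\<forall>\<beta>\<in>{1..<\<alpha>}. Poly_Mapping.lookup x \<beta> + Poly_Mapping.lookup y \<beta> \<le> e \<beta>"
      using e by (simp add: m lookup_add)
    note B' = B[OF x y this]
    have "b1 \<le> Poly_Mapping.lookup x \<alpha>" "b2 \<le> Poly_Mapping.lookup y \<alpha>"
      using b1[OF x] b2[OF y] B' by blast+
    then show "b1 + b2 \<le> Poly_Mapping.lookup m \<alpha>"
      by (simp add: m lookup_add)
  qed
qed

lemma finite_laurent_supp:
  assumes "laurent_supp n S"
  shows "finite {x \<in> S. \<forall>\<beta>\<in>{1..n}. Poly_Mapping.lookup x \<beta> \<le> D \<beta>}"
proof -
  have "laurent_supp n {0}"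
    by (auto simp: laurent_supp_def)
  from finite_imageI[OF finite_laurent_supp_pairs[OF assms this, of D], of fst] show ?thesis
    by (rule finite_subset[rotated]) (auto simp: image_iff)
qed

section \<open>Products of Laurent series and their pairings\<close>

lemma laurent_supp_zmult:
  assumes "laurent_supp n {m. F m \<noteq> 0}" "laurent_supp n {m. G m \<noteq> 0}"
  shows "laurent_supp n {m. zmult F G m \<noteq> 0}"
proof (rule laurent_supp_subset[OF laurent_supp_sum[OF assms]], safe)
  fix m assume "zmult F G m \<noteq> 0"
  then obtain d where "F d * G (m - d) \<noteq> 0"
    unfolding zmult_def by (rule Sum_any.not_neutral_obtains_not_neutral)
  then show "\<exists>x y. m = x + y \<and> x \<in> {m. F m \<noteq> 0} \<and> y \<in> {m. G m \<noteq> 0}"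
    by (intro exI[of _ d] exI[of _ "m - d"]) auto
qed

lemma zmult_commute: "zmult F G = zmult G F"
proof
  fix m :: zmon
  have "bij (\<lambda>d. m - d)"
    by (rule bij_betw_byWitness[of _ "\<lambda>d. m - d"]) (auto simp: algebra_simps)
  then show "zmult F G m = zmult G F m"
    unfolding zmult_def by (rule Sum_any.reindex_cong) (simp add: o_def mult.commute)
qed

text \<open>Fubini for a product of kernels against a function vanishing at large exponents: only
  finitely many pairs \<open>(a, b)\<close> contribute. The bound may depend on \<open>i\<close>, so
  translates of such a function are admissible too.\<close>

lemma zmult_pairing:
  assumes F: "laurent_supp n {m. F m \<noteq> 0}" and G: "laurent_supp n {m. G m \<noteq> 0}"
    and \<Phi>: "\<And>m i. \<Phi> m \<noteq> 0 \<Longrightarrow> Poly_Mapping.lookup m i \<le> D i"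
  shows "Sum_any (\<lambda>e. smult (zmult F G e) (\<Phi> e)) =
    Sum_any (\<lambda>a. smult (F a) (Sum_any (\<lambda>b. smult (G b) (\<Phi> (a + b)))))"
proof -
  let ?Q = "{(a, b). F a \<noteq> 0 \<and> G b \<noteq> 0 \<and> \<Phi> (a + b) \<noteq> 0}"
  have Q: "finite ?Q"
    by (rule finite_subset[OF _ finite_laurent_supp_pairs[OF F G, of D]])
      (use \<Phi> in \<open>auto simp: lookup_add[symmetric]\<close>)
  let ?g = "\<lambda>a b. smult (F a * G b) (\<Phi> (a + b))"
  have g: "(a, b) \<in> ?Q" if "?g a b \<noteq> 0" for a b
    using that by auto
  \<comment> \<open>Finiteness of the convolution at \<open>e\<close> is read off from
    \<open>?Q\<close>, which sees it only if \<open>\<Phi> e \<noteq> 0\<close>.\<close>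
  have 1: "smult (zmult F G e) (\<Phi> e) = Sum_any (\<lambda>d. ?g d (e - d))" for e
  proof (cases "\<Phi> e = 0")
    case False
    have "{d. F d * G (e - d) \<noteq> 0} \<subseteq> fst ` ?Q"
    proof
      fix d assume "d \<in> {d. F d * G (e - d) \<noteq> 0}"
      with False show "d \<in> fst ` ?Q"
        by (intro image_eqI[of _ _ "(d, e - d)"]) auto
    qed
    then have "finite {d. F d * G (e - d) \<noteq> 0}"
      using Q by (blast intro: finite_subset finite_imageI)
    then show ?thesis
      unfolding zmult_def
      by (subst Sum_any_hom[where h = "\<lambda>c. smult c (\<Phi> e)"]) (auto simp: sym.scale_left_distrib)
  qed simp
  have 2: "smult (F a) (Sum_any (\<lambda>b. smult (G b) (\<Phi> (a + b)))) = Sum_any (?g a)" for a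
  proof (cases "F a = 0")
    case False
    have "{b. smult (G b) (\<Phi> (a + b)) \<noteq> 0} \<subseteq> snd ` ?Q"
    proof
      fix b assume "b \<in> {b. smult (G b) (\<Phi> (a + b)) \<noteq> 0}"
      with False show "b \<in> snd ` ?Q"
        by (intro image_eqI[of _ _ "(a, b)"]) auto
    qed
    then have "finite {b. smult (G b) (\<Phi> (a + b)) \<noteq> 0}"
      using Q by (blast intro: finite_subset finite_imageI)
    then show ?thesis
      by (subst Sum_any_hom[where h = "smult (F a)"]) (auto simp: sym.scale_right_distrib)
  qed simp
  let ?X = "{e. \<exists>d. ?g d (e - d) \<noteq> 0}" and ?Y = "{d. \<exists>e. ?g d (e - d) \<noteq> 0}"
  have X: "?X \<subseteq> (\<lambda>(a, b). a + b) ` ?Q"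
  proof
    fix e assume "e \<in> ?X"
    then obtain d where "?g d (e - d) \<noteq> 0" by blast
    from g[OF this] show "e \<in> (\<lambda>(a, b). a + b) ` ?Q"
      by (intro image_eqI[of _ _ "(d, e - d)"]) auto
  qed
  have Y: "?Y \<subseteq> fst ` ?Q"
  proof
    fix d assume "d \<in> ?Y"
    then obtain e where "?g d (e - d) \<noteq> 0" by blast
    from g[OF this] show "d \<in> fst ` ?Q"
      by (intro image_eqI[of _ _ "(d, e - d)"]) auto
  qed
  have "finite (?X \<times> ?Y)"
    using finite_subset[OF X] finite_subset[OF Y] Q by (intro finite_cartesian_product) blast+
  then have "Sum_any (\<lambda>e. Sum_any (\<lambda>d. ?g d (e - d))) = Sum_any (\<lambda>d. Sum_any (\<lambda>e. ?g d (e - d)))"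
    by (rule Sum_any.swap) simp
  also have "\<dots> = Sum_any (\<lambda>d. Sum_any (?g d))"
  proof (rule Sum_any.cong)
    show "Sum_any (\<lambda>e. ?g d (e - d)) = Sum_any (?g d)" for d
      using Sum_any_shift[of "?g d" "- d"] by (simp only: add_uminus_conv_diff)
  qed
  finally show ?thesis
    by (simp only: 1 2)
qed

section \<open>The kernel of a composition\<close>

lemma vertex_operator_eq: "vertex_operator r K f = Sum_any (\<lambda>d. smult (K d) (vertex_coeff r (- d) f))"
  unfolding vertex_operator_def op_mult_def[of "op_scalar K"] op_mult_vertex_coeff by (simp add: op_scalar_def)

lemma lookup_map_key_add:
  "Poly_Mapping.lookup (Poly_Mapping.map_key (\<lambda>\<alpha>. \<alpha> + s) m) i = Poly_Mapping.lookup m (i + s)"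
  for s i :: nat
  by (subst map_key.rep_eq) (auto simp: inj_def)

lemma map_key_shift_mon: "Poly_Mapping.map_key (\<lambda>\<alpha>. \<alpha> + s) (shift_mon s a) = a"
  by (rule poly_mapping_eqI) (simp add: lookup_map_key_add lookup_shift_mon)

lemma shift_mon_map_key:
  assumes "Poly_Mapping.keys m \<subseteq> {s<..}"
  shows "shift_mon s (Poly_Mapping.map_key (\<lambda>\<alpha>. \<alpha> + s) m) = m"
proof (rule poly_mapping_eqI)
  fix i
  have "Poly_Mapping.lookup m i = 0" if "i < s"
    using assms that by (intro not_in_keys_iff_lookup_eq_zero[THEN iffD1]) auto
  then show "Poly_Mapping.lookup (shift_mon s (Poly_Mapping.map_key (\<lambda>\<alpha>. \<alpha> + s) m)) i = Poly_Mapping.lookup m i"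
    by (simp add: lookup_map_key_add lookup_shift_mon)
qed

lemma zshift_shift_mon:
  assumes "laurent_supp r {m. K m \<noteq> 0}"
  shows "zshift s K (shift_mon s a) = K a"
proof (cases "K a = 0")
  case False
  have "Poly_Mapping.keys (shift_mon s a) \<subseteq> {s<..}"
  proof
    fix i assume "i \<in> Poly_Mapping.keys (shift_mon s a)"
    then have "s \<le> i" "i - s \<in> Poly_Mapping.keys a"
      by (auto simp: in_keys_iff lookup_shift_mon split: if_splits)
    with laurent_supp_keys[OF assms, of a] False show "i \<in> {s<..}" by fastforce
  qed
  then show ?thesis
    by (simp add: zshift_def map_key_shift_mon)
qed (simp add: zshift_def map_key_shift_mon)

lemma zshift_nz:
  assumes "zshift s K m \<noteq> 0"
  obtains a where "m = shift_mon s a" "K a \<noteq> 0"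
  using assms shift_mon_map_key[of m s] by (metis zshift_def)

lemma Sum_any_inj:
  assumes "inj f" "\<And>y. g y \<noteq> 0 \<Longrightarrow> y \<in> range f"
  shows "Sum_any g = Sum_any (\<lambda>x. g (f x))"
proof -
  have "{y. g y \<noteq> 0} = f ` {x. g (f x) \<noteq> 0}"
    using assms(2) by auto
  then show ?thesis
    unfolding Sum_any.expand_set
    using sum.reindex[of f "{x. g (f x) \<noteq> 0}" g] assms(1) by (simp add: inj_on_def inj_def)
qed

text \<open>For \<open>\<alpha> > s\<close>, fixing the exponents before \<open>\<alpha>\<close>
  fixes those of the unshifted monomial before \<open>\<alpha> - s\<close>; up to \<open>s\<close>
  all exponents are 0.\<close>

lemma laurent_supp_zshift:
  assumes K: "laurent_supp r {m. K m \<noteq> 0}"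
  shows "laurent_supp (r + s) {m. zshift s K m \<noteq> 0}"
  unfolding laurent_supp_def
proof (intro conjI ballI allI)
  fix m assume "m \<in> {m. zshift s K m \<noteq> 0}"
  then obtain a where a: "m = shift_mon s a" "K a \<noteq> 0"
    by (auto elim: zshift_nz)
  show "Poly_Mapping.keys m \<subseteq> {1..r+s}"
  proof
    fix i assume "i \<in> Poly_Mapping.keys m"
    then have "s \<le> i" "i - s \<in> Poly_Mapping.keys a"
      by (auto simp: in_keys_iff lookup_shift_mon a split: if_splits)
    with laurent_supp_keys[OF K, of a] a show "i \<in> {1..r+s}" by fastforce
  qed
next
  fix \<alpha> :: nat and e :: "nat \<Rightarrow> int"
  assume \<alpha>: "\<alpha> \<in> {1..r+s}"
  show "\<exists>b. \<forall>m\<in>{m. zshift s K m \<noteq> 0}. (\<forall>\<beta>\<in>{1..<\<alpha>}. Poly_Mapping.lookup m \<beta> = e \<beta>) \<longrightarrow>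
    b \<le> Poly_Mapping.lookup m \<alpha>"
  proof (cases "\<alpha> \<le> s")
    case True
    have "0 \<le> Poly_Mapping.lookup m \<alpha>" if m: "zshift s K m \<noteq> 0" for m
    proof -
      obtain a where a: "m = shift_mon s a" "K a \<noteq> 0"
        using m by (rule zshift_nz)
      have "Poly_Mapping.lookup a 0 = 0"
        using laurent_supp_keys[OF K, of a] a by (intro keys_0) auto
      with True show ?thesis
        by (simp add: a lookup_shift_mon)
    qed
    then show ?thesis by blast
  next
    case False
    then have "\<alpha> - s \<in> {1..r}" using \<alpha> by auto
    with K obtain b where b: "\<And>a. K a \<noteq> 0 \<Longrightarrow>
        (\<forall>\<beta>\<in>{1..<\<alpha> - s}. Poly_Mapping.lookup a \<beta> = e (\<beta> + s)) \<Longrightarrow> b \<le> Poly_Mapping.lookup a (\<alpha> - s)"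
      unfolding laurent_supp_def by (metis (mono_tags, lifting) mem_Collect_eq)
    show ?thesis
    proof (intro exI[of _ b] ballI impI)
      fix m assume "m \<in> {m. zshift s K m \<noteq> 0}" and e: "\<forall>\<beta>\<in>{1..<\<alpha>}. Poly_Mapping.lookup m \<beta> = e \<beta>"
      then obtain a where a: "m = shift_mon s a" "K a \<noteq> 0"
        by (auto elim: zshift_nz)
      have "Poly_Mapping.lookup a \<beta> = e (\<beta> + s)" if "\<beta> \<in> {1..<\<alpha> - s}" for \<beta>
        using that e[rule_format, of "\<beta> + s"] by (auto simp: a lookup_shift_mon)
      with b[OF a(2)] False show "b \<le> Poly_Mapping.lookup m \<alpha>"
        by (simp add: a lookup_shift_mon)
    qed
  qed
qed

lemma laurent_supp_extend:
  assumes K: "laurent_supp s S"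
  shows "laurent_supp (r + s) S"
  unfolding laurent_supp_def
proof (intro conjI ballI allI)
  fix m assume "m \<in> S"
  from laurent_supp_keys[OF K this] show "Poly_Mapping.keys m \<subseteq> {1..r+s}" by auto
next
  fix \<alpha> :: nat and e :: "nat \<Rightarrow> int"
  assume \<alpha>: "\<alpha> \<in> {1..r+s}"
  show "\<exists>b. \<forall>m\<in>S. (\<forall>\<beta>\<in>{1..<\<alpha>}. Poly_Mapping.lookup m \<beta> = e \<beta>) \<longrightarrow> b \<le> Poly_Mapping.lookup m \<alpha>"
  proof (cases "\<alpha> \<le> s")
    case True
    with K \<alpha> show ?thesis by (simp add: laurent_supp_def)
  next
    case False
    have "Poly_Mapping.lookup m \<alpha> = 0" if "m \<in> S" for m
      using laurent_supp_keys[OF K that] False by (intro not_in_keys_iff_lookup_eq_zero[THEN iffD1]) auto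
    then show ?thesis by (intro exI[of _ 0]) simp
  qed
qed

text \<open>Here the direction of expansion matters: exponents up to \<open>s\<close> are
  nonnegative, and once they are fixed, so is \<open>wt s c\<close>, whose negative bounds the later
  ones.\<close>

lemma laurent_supp_cross_factor: "laurent_supp (r + s) {c. cross_factor r s c \<noteq> 0}"
  unfolding laurent_supp_def
proof (intro conjI ballI allI)
  fix c assume "c \<in> {c. cross_factor r s c \<noteq> 0}"
  then show "Poly_Mapping.keys c \<subseteq> {1..r+s}"
    by (intro cross_factor_support(1)) simp
next
  fix \<alpha> :: nat and e :: "nat \<Rightarrow> int"
  show "\<exists>b. \<forall>c\<in>{c. cross_factor r s c \<noteq> 0}. (\<forall>\<beta>\<in>{1..<\<alpha>}. Poly_Mapping.lookup c \<beta> = e \<beta>) \<longrightarrow>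
    b \<le> Poly_Mapping.lookup c \<alpha>"
  proof (cases "\<alpha> \<le> s")
    case True
    then show ?thesis
      using cross_factor_support(2) by blast
  next
    case False
    show ?thesis
    proof (intro exI[of _ "- (\<Sum>\<beta>=1..s. e \<beta>)"] ballI impI)
      fix c assume c: "c \<in> {c. cross_factor r s c \<noteq> 0}" and e: "\<forall>\<beta>\<in>{1..<\<alpha>}. Poly_Mapping.lookup c \<beta> = e \<beta>"
      have "wt s c = (\<Sum>\<beta>=1..s. e \<beta>)"
        unfolding wt_def by (rule sum.cong) (use e False in auto)
      with c cross_factor_bounded_below[of r s c \<alpha>]
      show "- (\<Sum>\<beta>=1..s. e \<beta>) \<le> Poly_Mapping.lookup c \<alpha>" by simp
    qed
  qed
qed

text \<open>
  Writing the kernel as \<open>K\<^sub>B (K\<^sub>A C)\<close> lets the linear operator \<open>A\<close> act on each term of the outer sum,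
  so that associativity of \<open>zmult\<close>, which needs its own finiteness argument, is never used.
\<close>

lemma vertex_operator_compose:
  assumes A: "Vector_Spaces.linear smult smult A" "A = vertex_operator r KA"
    and KA: "laurent_supp r {m. KA m \<noteq> 0}" and KB: "laurent_supp s {m. KB m \<noteq> 0}"
  shows "A (vertex_operator s KB f) =
    vertex_operator (r + s) (zmult (zmult (cross_factor r s) (zshift s KA)) KB) f"
proof -
  let ?C = "cross_factor r s" and ?K = "zshift s KA"
  define \<Phi> where "\<Phi> e = vertex_coeff (r + s) (- e) f" for e
  obtain D :: nat where D: "\<And>m i. vertex_coeff (r + s) m f \<noteq> 0 \<Longrightarrow> - int D \<le> Poly_Mapping.lookup m i"
    using vertex_coeff_bounded_below[of "r + s" f] by blast
  have \<Phi>: "Poly_Mapping.lookup e i \<le> int D" if "\<Phi> e \<noteq> 0" for e i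
    using D[OF that[unfolded \<Phi>_def], of i] by simp
  interpret A: Vector_Spaces.linear smult smult A by (rule A(1))
  have fin: "finite {b. smult (KB b) (vertex_coeff s (- b) f) \<noteq> 0}"
  proof -
    obtain D :: nat where D: "\<And>m i. vertex_coeff s m f \<noteq> 0 \<Longrightarrow> - int D \<le> Poly_Mapping.lookup m i"
      using vertex_coeff_bounded_below[of s f] by blast
    have "Poly_Mapping.lookup b i \<le> int D" if "vertex_coeff s (- b) f \<noteq> 0" for b i
      using D[OF that, of i] by simp
    then show ?thesis
      by (intro finite_subset[OF _ finite_laurent_supp[OF KB, of "\<lambda>_. int D"]]) auto
  qed
  \<comment> \<open>The factor \<open>KB b\<close> confines \<open>b\<close> to
    \<open>z_1, ..., z_s\<close>, as \<open>vertex_coeff_vertex_coeff\<close> requires.\<close>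
  have inner: "smult (KB b) (A (vertex_coeff s (- b) f)) =
      smult (KB b) (Sum_any (\<lambda>d. smult (zmult ?K ?C d) (\<Phi> (b + d))))" for b
  proof (cases "KB b = 0")
    case False
    then have b: "Poly_Mapping.keys (- b) \<subseteq> {1..s}"
      using laurent_supp_keys[OF KB, of b] by simp
    have "A (vertex_coeff s (- b) f) = Sum_any (\<lambda>a. smult (KA a) (vertex_coeff r (- a) (vertex_coeff s (- b) f)))"
      unfolding A(2) vertex_operator_eq ..
    also have "\<dots> = Sum_any (\<lambda>a. smult (?K (shift_mon s a)) (cross_coeff r s (- (b + shift_mon s a)) f))"
    proof (rule Sum_any.cong)
      fix a
      show "smult (KA a) (vertex_coeff r (- a) (vertex_coeff s (- b) f)) = smult (?K (shift_mon s a)) (cross_coeff r s (- (b + shift_mon s a)) f)"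
      proof (cases "KA a = 0")
        case False
        then have "Poly_Mapping.keys (- a) \<subseteq> {1..r}"
          using laurent_supp_keys[OF KA, of a] by simp
        moreover have "shift_mon s (- a) + - b = - (b + shift_mon s a)"
          using shift_mon_diff[of s 0 a] by simp
        ultimately show ?thesis
          by (simp only: vertex_coeff_vertex_coeff[OF _ b] zshift_shift_mon[OF KA])
      qed (simp add: zshift_shift_mon[OF KA])
    qed
    \<comment> \<open>The shifted kernel is supported on shifted monomials, so \<open>a\<close> may
      now range over all monomials.\<close>
    also have "\<dots> = Sum_any (\<lambda>a. smult (?K a) (cross_coeff r s (- (b + a)) f))"
    proof (rule Sum_any_inj[symmetric])
      show "inj (shift_mon s)"
        by (rule inj_on_inverseI) (rule map_key_shift_mon)
      fix y assume "smult (?K y) (cross_coeff r s (- (b + y)) f) \<noteq> 0"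
      then have "?K y \<noteq> 0" by auto
      then show "y \<in> range (shift_mon s)"
        by (auto elim: zshift_nz)
    qed
    also have "\<dots> = Sum_any (\<lambda>a. smult (?K a) (Sum_any (\<lambda>c. smult (?C c) (\<Phi> (b + (a + c))))))"
      by (simp add: cross_coeff_def \<Phi>_def algebra_simps)
    \<comment> \<open>First pairing, at fixed \<open>b\<close>: the translate of
      \<open>\<Phi>\<close> by \<open>b\<close> still vanishes at large exponents.\<close>
    also have "\<dots> = Sum_any (\<lambda>d. smult (zmult ?K ?C d) (\<Phi> (b + d)))"
    proof (rule zmult_pairing[symmetric, OF laurent_supp_zshift[OF KA] laurent_supp_cross_factor])
      fix m i assume "\<Phi> (b + m) \<noteq> 0"
      from \<Phi>[OF this, of i] show "Poly_Mapping.lookup m i \<le> int D - Poly_Mapping.lookup b i"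
        by (simp add: lookup_add)
    qed
    finally show ?thesis by simp
  qed simp
  \<comment> \<open>For fixed \<open>f\<close> only finitely many \<open>b\<close> contribute, so
    \<open>A\<close> passes under the sum.\<close>
  have "A (vertex_operator s KB f) = Sum_any (\<lambda>b. A (smult (KB b) (vertex_coeff s (- b) f)))"
    unfolding vertex_operator_eq by (rule Sum_any_hom[OF A.add A.zero fin])
  also have "\<dots> = Sum_any (\<lambda>b. smult (KB b) (Sum_any (\<lambda>d. smult (zmult ?K ?C d) (\<Phi> (b + d)))))"
    by (simp only: A.scale inner)
  \<comment> \<open>Second pairing, with \<open>KB\<close> as the outer factor.\<close>
  also have "\<dots> = Sum_any (\<lambda>e. smult (zmult KB (zmult ?K ?C) e) (\<Phi> e))"
    by (rule zmult_pairing[symmetric, OF laurent_supp_extend[OF KB] laurent_supp_zmult[OF laurent_supp_zshift[OF KA] laurent_supp_cross_factor]])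
      (rule \<Phi>)
  also have "\<dots> = vertex_operator (r + s) (zmult (zmult ?C ?K) KB) f"
    unfolding vertex_operator_eq \<Phi>_def zmult_commute[of KB] zmult_commute[of ?K] ..
  finally show ?thesis .
qed

lemma macdonald_diagonal_comp:
  assumes A: "macdonald_diagonal A" and B: "macdonald_diagonal B"
  shows "macdonald_diagonal (A \<circ> B)"
  unfolding macdonald_diagonal_def
proof (intro conjI allI impI)
  show lin: "Vector_Spaces.linear smult smult (A \<circ> B)"
    using A B unfolding macdonald_diagonal_def by (blast intro: Vector_Spaces.linear_compose)
  interpret A: Vector_Spaces.linear smult smult A
    using A unfolding macdonald_diagonal_def by blast
  fix \<mu> assume \<mu>: "is_partition \<mu>"
  with A show "macdonald_P \<mu> \<noteq> 0"
    by (simp add: macdonald_diagonal_def)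
  from A B \<mu> obtain a b where "A (macdonald_P \<mu>) = smult a (macdonald_P \<mu>)"
      "B (macdonald_P \<mu>) = smult b (macdonald_P \<mu>)"
    unfolding macdonald_diagonal_def by blast
  then have "(A \<circ> B) (macdonald_P \<mu>) = smult (b * a) (macdonald_P \<mu>)"
    by (simp add: A.scale)
  then show "\<exists>a. (A \<circ> B) (macdonald_P \<mu>) = smult a (macdonald_P \<mu>)" ..
qed

theorem proposition6p1:
  fixes r s :: nat
    and A B :: "sym \<Rightarrow> sym"
    and K\<^sub>A K\<^sub>B :: "qt zseries"
  assumes "vertex_realizable r A" and "vertex_kernel r K\<^sub>A A"
    and "vertex_realizable s B" and "vertex_kernel s K\<^sub>B B"
  shows "vertex_realizable (r + s) (A \<circ> B) \<and>
    vertex_kernel (r + s) (zmult (zmult (cross_factor r s) (zshift s K\<^sub>A)) K\<^sub>B) (A \<circ> B)"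
proof -
  let ?K = "zmult (zmult (cross_factor r s) (zshift s K\<^sub>A)) K\<^sub>B"
  have KA: "laurent_supp r {m. K\<^sub>A m \<noteq> 0}" "A = vertex_operator r K\<^sub>A"
    and KB: "laurent_supp s {m. K\<^sub>B m \<noteq> 0}" "B = vertex_operator s K\<^sub>B"
    using assms by (simp_all add: vertex_kernel_def iterated_laurent_laurent_supp)
  have diag: "macdonald_diagonal A" "macdonald_diagonal B" and "1 \<le> r"
    using assms by (simp_all add: vertex_realizable_def)
  have "laurent_supp (r + s) {m. ?K m \<noteq> 0}"
    by (intro laurent_supp_zmult laurent_supp_cross_factor laurent_supp_zshift laurent_supp_extend KA KB)
  moreover have "(A \<circ> B) f = vertex_operator (r + s) ?K f" for f
  proof -
    have "Vector_Spaces.linear smult smult A"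
      using diag by (simp add: macdonald_diagonal_def)
    from vertex_operator_compose[OF this KA(2,1) KB(1)] show ?thesis
      by (simp add: KB(2))
  qed
  ultimately have "vertex_kernel (r + s) ?K (A \<circ> B)"
    by (auto simp: vertex_kernel_def iterated_laurent_laurent_supp)
  with diag \<open>1 \<le> r\<close> show ?thesis
    by (auto simp: vertex_realizable_def macdonald_diagonal_comp)
qed

end
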